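(* For every integer $n\ge 3$ and every positive integer $r$, the regular $n$-gon in a plane in $\mathbb{R}^3$ with side length $r$ (regarded as a closed polygon with $nr$ unit edges, each side subdivided into $r$ unit segments) can be domed.
   Context: A closed polygon with unit edges $\gamma=[v_1\dots v_N]$ can be domed if there is a dome over it: a finite connected 2-dimensional simplicial complex $\Sigma$ which is a compact surface whose boundary is a single cycle, with a map $f:\Sigma\to\mathbb{R}^3$ linear on each simplex, sending every triangle to an equilateral triangle of side $1$ and sending the boundary cycle of $\Sigma$ onto $\gamma$ vertex by vertex in cyclic order (no embedding/immersion required). *)

theory Defs
  imports "HOL-Analysis.Analysis"
begin

text \<open>Abstract 2-dimensional simplicial complexes are given by their set of
  triangles (3-element sets of vertex labels); vertices and edges are the faces
  of these triangles (the complex is pure, as a compact surface must be).\<close>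

definition cx_verts :: "nat set set \<Rightarrow> nat set" where
  "cx_verts T = \<Union> T"

definition cx_edges :: "nat set set \<Rightarrow> nat set set" where
  "cx_edges T = {e. \<exists>t\<in>T. e \<subseteq> t \<and> card e = 2}"

definition edge_count :: "nat set set \<Rightarrow> nat set \<Rightarrow> nat" where
  "edge_count T e = card {t\<in>T. e \<subseteq> t}"

definition boundary_edges :: "nat set set \<Rightarrow> nat set set" where
  "boundary_edges T = {e\<in>cx_edges T. edge_count T e = 1}"

text \<open>Combinatorial compact connected surface (with possibly nonempty boundary):
  finitely many triangles, every edge lies in one or two triangles, the link of
  every vertex is connected (hence a path or a cycle), and the 1-skeleton is
  connected.\<close>

definition surface_complex :: "nat set set \<Rightarrow> bool" where
  "surface_complex T \<longleftrightarrow>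
     finite T \<and> T \<noteq> {} \<and> (\<forall>t\<in>T. card t = 3) \<and>
     (\<forall>e\<in>cx_edges T. edge_count T e = 1 \<or> edge_count T e = 2) \<and>
     (\<forall>v\<in>cx_verts T. \<forall>a b. {v,a} \<in> cx_edges T \<longrightarrow> {v,b} \<in> cx_edges T \<longrightarrow>
         (\<lambda>x y. {v,x,y} \<in> T)\<^sup>*\<^sup>* a b) \<and>
     (\<forall>a\<in>cx_verts T. \<forall>b\<in>cx_verts T. (\<lambda>x y. {x,y} \<in> cx_edges T)\<^sup>*\<^sup>* a b)"

definition boundary_cycle :: "nat set set \<Rightarrow> nat list \<Rightarrow> bool" where
  "boundary_cycle T w \<longleftrightarrow> distinct w \<and> length w \<ge> 3 \<and>
     boundary_edges T = {{w ! i, w ! ((i + 1) mod length w)} | i. i < length w}"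

text \<open>A closed polygon, given as the list of its vertices [v_1,...,v_N], can be
  domed.  The map is given on vertices (it is then the linear extension on each
  simplex); every triangle goes to an equilateral triangle of side 1 and the
  boundary cycle goes to the polygon vertex by vertex in cyclic order.\<close>

definition can_be_domed :: "(real^3) list \<Rightarrow> bool" where
  "can_be_domed \<gamma> \<longleftrightarrow>
     (\<exists>T (f :: nat \<Rightarrow> real^3) w.
        surface_complex T \<and> boundary_cycle T w \<and> length w = length \<gamma> \<and>
        (\<forall>t\<in>T. \<forall>a\<in>t. \<forall>b\<in>t. a \<noteq> b \<longrightarrow> dist (f a) (f b) = 1) \<and>
        (\<forall>i < length \<gamma>. f (w ! i) = \<gamma> ! i))"

definition ngon_corner :: "nat \<Rightarrow> nat \<Rightarrow> real^3 \<Rightarrow> real^3 \<Rightarrow> real^3 \<Rightarrow> nat \<Rightarrow> real^3" where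
  "ngon_corner n r c e1 e2 k =
     c + (real r / (2 * sin (pi / real n))) *\<^sub>R
         (cos (2 * pi * real k / real n) *\<^sub>R e1 + sin (2 * pi * real k / real n) *\<^sub>R e2)"

definition subdivided_ngon :: "nat \<Rightarrow> nat \<Rightarrow> real^3 \<Rightarrow> real^3 \<Rightarrow> real^3 \<Rightarrow> (real^3) list" where
  "subdivided_ngon n r c e1 e2 =
     map (\<lambda>m. ngon_corner n r c e1 e2 (m div r) +
               (real (m mod r) / real r) *\<^sub>R
                 (ngon_corner n r c e1 e2 (m div r + 1) - ngon_corner n r c e1 e2 (m div r)))
         [0..<n * r]"

end

theory Submission
  imports Defs
begin

text \<open>A closed polygon with unit edges is a closed word of unit vectors.  Gluing a triangle to the
  boundary of a dome replaces a letter \<open>p + q\<close> by \<open>p, q\<close> or conversely, where \<open>p\<close>, \<open>q\<close>, \<open>p + q\<close> are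
  unit vectors, so the words that can be domed are closed under these moves.  The moves lift to
  triangles of side \<open>r\<close> (repeat every letter \<open>r\<close> times), which reduces the theorem to \<open>r = 1\<close>.

  For \<open>r = 1\<close>, start at an apex at unit distance from all vertices of a horizontal regular \<open>n\<close>-gon of
  radius \<open>t\<close>, and build concentric regular \<open>n\<close>-gons (rings), each one turned by \<open>\<pi>/n\<close> against the
  previous one and at unit distance from it.  A new ring arises from the last but one by rotating each
  of its vertices about the line through the two adjacent vertices of the last ring, by three times
  the angle that belongs to a unit chord; this is a sequence of gluings of triangles.  If the senses of
  rotation are chosen well, then for \<open>t = 1\<close> the radii of the rings grow without bound until the side
  length reaches 1, whereas for \<open>t = 0\<close> all radii are 0.  By the intermediate value theorem, some \<open>t\<close>
  gives a ring with side length exactly 1, and this ring bounds a dome.\<close>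

section \<open>Gluing triangles to surfaces\<close>

lemma cx_edges_insert: "cx_edges (insert t T) = cx_edges T \<union> {e. e \<subseteq> t \<and> card e = 2}"
  by (auto simp: cx_edges_def)

lemma cx_edge_insertD:
  "{a, b} \<in> cx_edges (insert t T) \<Longrightarrow> {a, b} \<in> cx_edges T \<or> a \<in> t \<and> b \<in> t"
  by (auto simp: cx_edges_insert)

lemma cx_edge_in_verts: "{a, b} \<in> cx_edges T \<Longrightarrow> a \<in> cx_verts T \<and> b \<in> cx_verts T"
  by (auto simp: cx_edges_def cx_verts_def)

lemma edge_count_insert:
  assumes "finite T" "t \<notin> T"
  shows "edge_count (insert t T) e = edge_count T e + (if e \<subseteq> t then 1 else 0)"
proof -
  have "{s \<in> insert t T. e \<subseteq> s} = (if e \<subseteq> t then insert t {s \<in> T. e \<subseteq> s} else {s \<in> T. e \<subseteq> s})"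
    by auto
  then show ?thesis
    using assms by (simp add: edge_count_def)
qed

lemma edge_count_eq_0_iff:
  assumes "finite T" "card e = 2"
  shows "edge_count T e = 0 \<longleftrightarrow> e \<notin> cx_edges T"
  using assms by (auto simp: edge_count_def cx_edges_def)

text \<open>Each old vertex \<open>v\<close> of \<open>t\<close> has a boundary edge
  \<open>{v, c}\<close> inside \<open>t\<close>, so the new part of its link hangs on the old link
  at \<open>c\<close>; edge counts stay at most 2 because an old side of \<open>t\<close> was a
  boundary edge. The side \<open>{a0, b0}\<close> keeps the complex connected, and
  \<open>{a1, b1}\<close> guarantees that \<open>t\<close> was not there before.\<close>

lemma surface_complex_insert:
  assumes S: "surface_complex T" and t: "card t = 3"
    and sides: "\<And>e. e \<subseteq> t \<Longrightarrow> card e = 2 \<Longrightarrow> e \<in> boundary_edges T \<or> e \<notin> cx_edges T"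
    and verts: "\<And>v. v \<in> t \<Longrightarrow> v \<in> cx_verts T \<Longrightarrow> \<exists>c\<in>t. {v, c} \<in> boundary_edges T"
    and old: "a0 \<in> t" "b0 \<in> t" "{a0, b0} \<in> boundary_edges T"
    and new: "a1 \<in> t" "b1 \<in> t" "a1 \<noteq> b1" "{a1, b1} \<notin> cx_edges T"
  shows "surface_complex (insert t T)"
    and "boundary_edges (insert t T) =
      (boundary_edges T - Pow t) \<union> {e. e \<subseteq> t \<and> card e = 2 \<and> e \<notin> cx_edges T}"
proof -
  have fin: "finite T" and c3: "\<And>s. s \<in> T \<Longrightarrow> card s = 3"
    and cnt: "\<And>e. e \<in> cx_edges T \<Longrightarrow> edge_count T e = 1 \<or> edge_count T e = 2"
    and link: "\<And>v a b. {v, a} \<in> cx_edges T \<Longrightarrow> {v, b} \<in> cx_edges T \<Longrightarrow> (\<lambda>x y. {v, x, y} \<in> T)\<^sup>*\<^sup>* a b"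
    and conn: "\<And>a b. a \<in> cx_verts T \<Longrightarrow> b \<in> cx_verts T \<Longrightarrow> (\<lambda>x y. {x, y} \<in> cx_edges T)\<^sup>*\<^sup>* a b"
    using S unfolding surface_complex_def by (simp_all add: cx_edge_in_verts)
  let ?T = "insert t T"
  have ft: "finite t" using t by (metis card.infinite zero_neq_numeral)
  have tT: "t \<notin> T"
    using new by (auto simp: cx_edges_def)
  have bd: "e \<in> cx_edges T \<and> edge_count T e = 1" if "e \<in> boundary_edges T" for e
    using that by (auto simp: boundary_edges_def)
  have nz: "edge_count T e = 0" if "e \<notin> cx_edges T" "card e = 2" for e
    using edge_count_eq_0_iff fin that by blast
  have cnt': "edge_count ?T e = edge_count T e + (if e \<subseteq> t then 1 else 0)" for e
    using edge_count_insert[OF fin tT] .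
  have c2: "card e = 2" if "e \<in> cx_edges T" for e
    using that by (auto simp: cx_edges_def)
  have three: "{v, a, b} = t" if "v \<in> t" "a \<in> t" "b \<in> t" "v \<noteq> a" "v \<noteq> b" "a \<noteq> b" for v a b
    using that t ft by (intro card_subset_eq) auto
  have link': "(\<lambda>x y. {v, x, y} \<in> ?T)\<^sup>*\<^sup>* a b"
    if "{v, a} \<in> cx_edges T" "{v, b} \<in> cx_edges T" for v a b
    using link[OF that] by (rule rtranclp_mono[THEN predicate2D, rotated]) auto
  have sym': "symp (\<lambda>x y. {v, x, y} \<in> ?T)\<^sup>*\<^sup>*" for v
    by (intro symp_rtranclp sympI) (simp add: insert_commute)
  have L: "(\<lambda>x y. {v, x, y} \<in> ?T)\<^sup>*\<^sup>* a b"
    if a: "{v, a} \<in> cx_edges ?T" and b: "{v, b} \<in> cx_edges ?T" for v a b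
  proof (cases "v \<in> t")
    case False
    then show ?thesis
      using cx_edge_insertD[OF a] cx_edge_insertD[OF b] link' by blast
  next
    case True
    have va: "v \<noteq> a" "v \<noteq> b"
      using a b by (auto simp: cx_edges_def)
    show ?thesis
    proof (cases "v \<in> cx_verts T")
      case False
      then have "a \<in> t" "b \<in> t"
        using cx_edge_insertD[OF a] cx_edge_insertD[OF b] cx_edge_in_verts by blast+
      then show ?thesis
        using three[OF True] va by (cases "a = b") auto
    next
      case vT: True
      obtain c where c: "c \<in> t" "{v, c} \<in> boundary_edges T"
        using verts[OF True vT] by auto
      have vc: "{v, c} \<in> cx_edges T" "v \<noteq> c"
        using c bd c2[of "{v, c}"] by (auto dest!: bd)
      \<comment> \<open>All neighbours of \<open>v\<close> are linked to \<open>c\<close>: a new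
        neighbour lies in \<open>t\<close>, and then \<open>t\<close> itself joins it to
        \<open>c\<close> in the link.\<close>
      have toc: "(\<lambda>x y. {v, x, y} \<in> ?T)\<^sup>*\<^sup>* x c" if x: "{v, x} \<in> cx_edges ?T" "v \<noteq> x" for x
      proof (cases "{v, x} \<in> cx_edges T")
        case True
        then show ?thesis using link' vc by blast
      next
        case False
        then have "x \<in> t" using cx_edge_insertD[OF x(1)] by blast
        then show ?thesis
          using three[OF True, of x c] c vc x by (cases "x = c") auto
      qed
      show ?thesis
        using toc[OF a va(1)] toc[OF b va(2)] sym'[of v] by (meson rtranclp_trans sympD)
    qed
  qed
  have a0T: "a0 \<in> cx_verts T" "b0 \<in> cx_verts T"
    using old bd cx_edge_in_verts by blast+
  have conn': "(\<lambda>x y. {x, y} \<in> cx_edges ?T)\<^sup>*\<^sup>* a b" if "a \<in> cx_verts T" "b \<in> cx_verts T" for a b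
    using conn[OF that]
    by (rule rtranclp_mono[THEN predicate2D, rotated]) (auto simp: cx_edges_insert)
  have symc: "symp (\<lambda>x y. {x, y} \<in> cx_edges ?T)\<^sup>*\<^sup>*"
    by (intro symp_rtranclp sympI) (simp add: insert_commute)
  have toa: "(\<lambda>x y. {x, y} \<in> cx_edges ?T)\<^sup>*\<^sup>* x a0" if "x \<in> cx_verts ?T" for x
  proof (cases "x \<in> cx_verts T")
    case True
    then show ?thesis using conn' a0T by blast
  next
    case False
    then have "x \<in> t" "x \<noteq> a0" using that a0T by (auto simp: cx_verts_def)
    then have "{x, a0} \<in> cx_edges ?T" using old by (auto simp: cx_edges_insert)
    then show ?thesis by auto
  qed
  have C: "(\<lambda>x y. {x, y} \<in> cx_edges ?T)\<^sup>*\<^sup>* a b" if "a \<in> cx_verts ?T" "b \<in> cx_verts ?T" for a b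
    using toa[OF that(1)] toa[OF that(2)] symc by (meson rtranclp_trans sympD)
  have E: "edge_count ?T e = 1 \<or> edge_count ?T e = 2" if "e \<in> cx_edges ?T" for e
  proof (cases "e \<subseteq> t")
    case True
    then have "card e = 2" using that c2 by (auto simp: cx_edges_insert)
    then show ?thesis using sides[OF True] cnt'[of e] bd nz True by fastforce
  next
    case False
    then show ?thesis using that cnt cnt'[of e] by (auto simp: cx_edges_insert)
  qed
  show "surface_complex ?T"
    unfolding surface_complex_def using fin t c3 E L C by blast
  show "boundary_edges ?T =
      (boundary_edges T - Pow t) \<union> {e. e \<subseteq> t \<and> card e = 2 \<and> e \<notin> cx_edges T}"
  proof (intro set_eqI)
    fix e
    show "e \<in> boundary_edges ?T \<longleftrightarrow>
      e \<in> (boundary_edges T - Pow t) \<union> {e. e \<subseteq> t \<and> card e = 2 \<and> e \<notin> cx_edges T}"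
    proof (cases "e \<subseteq> t \<and> card e = 2")
      case True
      then have inT: "e \<in> cx_edges ?T" by (simp add: cx_edges_insert)
      show ?thesis
      proof (cases "e \<in> boundary_edges T")
        case b: True
        then have "edge_count ?T e = 2" using cnt'[of e] bd[OF b] True by simp
        then show ?thesis using b bd[OF b] True by (simp add: boundary_edges_def)
      next
        case False
        then have "e \<notin> cx_edges T" using sides True by blast
        then show ?thesis using inT nz cnt'[of e] True False by (simp add: boundary_edges_def)
      qed
    next
      case False
      then have "e \<in> cx_edges ?T \<longleftrightarrow> e \<in> cx_edges T" by (auto simp: cx_edges_insert)
      moreover have "\<not> e \<subseteq> t" if "e \<in> cx_edges T" using False that c2 by blast
      ultimately show ?thesis
        using cnt'[of e] False unfolding boundary_edges_def by auto
    qed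
  qed
qed

section \<open>Boundary cycles as closed paths, and gluing along them\<close>

fun path_edges :: "'a list \<Rightarrow> 'a set set" where
  "path_edges (x # y # l) = insert {x, y} (path_edges (y # l))"
| "path_edges _ = {}"

lemma path_edges_conv_nth: "path_edges l = {{l ! i, l ! Suc i} | i. Suc i < length l}"
proof (induction l rule: path_edges.induct)
  case (1 x y l)
  have "{{(x # y # l) ! i, (x # y # l) ! Suc i} | i. Suc i < length (x # y # l)} =
    insert {x, y} {{(y # l) ! i, (y # l) ! Suc i} | i. Suc i < length (y # l)}" (is "?L = ?R")
  proof
    show "?L \<subseteq> ?R"
    proof
      fix e assume "e \<in> ?L"
      then obtain i where "e = {(x # y # l) ! i, (x # y # l) ! Suc i}" "Suc i < length (x # y # l)"
        by blast
      then show "e \<in> ?R" by (cases i) auto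
    qed
    show "?R \<subseteq> ?L"
    proof
      fix e assume "e \<in> ?R"
      then consider "e = {x, y}" | i where "e = {(y # l) ! i, (y # l) ! Suc i}" "Suc i < length (y # l)"
        by blast
      then show "e \<in> ?L"
      proof cases
        case 1
        then show ?thesis by (intro CollectI exI[of _ 0]) auto
      next
        case (2 i)
        then show ?thesis by (intro CollectI exI[of _ "Suc i"]) auto
      qed
    qed
  qed
  then show ?case using 1 by simp
qed auto

lemma path_edges_append: "path_edges (l @ [x, y]) = insert {x, y} (path_edges (l @ [x]))"
  by (induction l rule: path_edges.induct) auto

lemma path_edges_subset: "e \<in> path_edges l \<Longrightarrow> e \<subseteq> set l"
  by (induction l rule: path_edges.induct) auto

lemma path_edges_meet: "e \<in> path_edges (l @ [a]) \<Longrightarrow> \<exists>y\<in>set l. y \<in> e"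
proof (induction l)
  case (Cons x l)
  then show ?case by (cases l) auto
qed simp

text \<open>The cycle becomes an open path that returns to its head; list induction then replaces
  indices modulo the length.\<close>

lemma closed_path_edges:
  assumes "w \<noteq> []"
  shows "{{w ! i, w ! ((i + 1) mod length w)} | i. i < length w} = path_edges (w @ [hd w])"
proof -
  have "w ! ((i + 1) mod length w) = (w @ [hd w]) ! Suc i" if "i < length w" for i
  proof (cases "Suc i = length w")
    case True
    then show ?thesis using assms by (simp add: nth_append hd_conv_nth)
  next
    case False
    then show ?thesis using that by (simp add: nth_append)
  qed
  moreover have "w ! i = (w @ [hd w]) ! i" if "i < length w" for i
    using that by (simp add: nth_append)
  ultimately show ?thesis
    unfolding path_edges_conv_nth by (intro Collect_cong ex_cong1) auto
qed

text \<open>A witness for \<open>can_be_domed\<close> of the polygon \<open>map f w\<close>. The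
  labels \<open>w\<close> stay visible because gluing acts on labels, and distinct labels may have
  equal images.\<close>

definition dome :: "nat set set \<Rightarrow> (nat \<Rightarrow> real^3) \<Rightarrow> nat list \<Rightarrow> bool" where
  "dome T f w \<longleftrightarrow> surface_complex T \<and> distinct w \<and> length w \<ge> 3 \<and>
     boundary_edges T = path_edges (w @ [hd w]) \<and>
     (\<forall>t\<in>T. \<forall>a\<in>t. \<forall>b\<in>t. a \<noteq> b \<longrightarrow> dist (f a) (f b) = 1)"

lemma can_be_domed_iff: "can_be_domed \<gamma> \<longleftrightarrow> (\<exists>T f w. dome T f w \<and> map f w = \<gamma>)"
proof -
  have "boundary_cycle T w \<longleftrightarrow> distinct w \<and> length w \<ge> 3 \<and> boundary_edges T = path_edges (w @ [hd w])"
    for T w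
  proof (cases "w = []")
    case False
    then show ?thesis unfolding boundary_cycle_def using closed_path_edges[OF False] by simp
  qed (simp add: boundary_cycle_def)
  then have "can_be_domed \<gamma> \<longleftrightarrow>
    (\<exists>T f w. dome T f w \<and> length w = length \<gamma> \<and> (\<forall>i<length \<gamma>. f (w ! i) = \<gamma> ! i))"
    unfolding can_be_domed_def dome_def by (intro ex_cong1) auto
  then show ?thesis
    unfolding list_eq_iff_nth_eq by (simp cong: conj_cong)
qed

lemma dome_rotate1:
  assumes "dome T f (a # w)"
  shows "dome T f (w @ [a])"
proof -
  obtain b w' where w: "w = b # w'"
    using assms by (cases w) (auto simp: dome_def)
  show ?thesis
    using assms path_edges_append[of "b # w'" a b] unfolding dome_def w by (auto simp: insert_commute)
qed

lemma dome_rotate: "dome T f (xs @ ys) \<Longrightarrow> dome T f (ys @ xs)"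
proof (induction xs arbitrary: ys)
  case (Cons x xs)
  then show ?case using dome_rotate1[of T f x "xs @ ys"] Cons.IH[of "ys @ [x]"] by simp
qed simp

lemma dome_verts:
  assumes "dome T f w" "v \<in> set w"
  shows "v \<in> cx_verts T"
proof -
  obtain xs ys where "w = xs @ v # ys"
    using assms(2) by (meson split_list)
  then have d: "dome T f (v # ys @ xs)"
    using assms(1) dome_rotate[of T f xs "v # ys"] by simp
  then obtain b l where "ys @ xs = b # l"
    by (cases "ys @ xs") (auto simp: dome_def)
  then have "{v, b} \<in> boundary_edges T"
    using d by (auto simp: dome_def)
  then show ?thesis
    using cx_edge_in_verts by (auto simp: boundary_edges_def)
qed

lemma ex_fresh_vertex:
  assumes "dome T f w"
  obtains v where "v \<notin> cx_verts T"
proof -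
  have "finite T" "\<And>t. t \<in> T \<Longrightarrow> finite t"
    using assms unfolding dome_def surface_complex_def by (auto intro: card_ge_0_finite)
  then have "finite (cx_verts T)"
    by (auto simp: cx_verts_def)
  then show ?thesis
    using that ex_new_if_finite infinite_UNIV_nat by blast
qed

lemma card_2_subset_triple:
  assumes "e \<subseteq> {a, b, c}" "card e = 2"
  shows "e = {a, b} \<or> e = {a, c} \<or> e = {b, c}"
proof -
  obtain x y where "e = {x, y}" "x \<noteq> y" using assms(2) by (meson card_2_iff)
  then show ?thesis using assms(1) by auto
qed

text \<open>Freshness of \<open>v\<close> makes both sides at \<open>v\<close> new, wherever
  \<open>x\<close> lies relative to the rest; only \<open>{a, b}\<close> leaves the
  boundary.\<close>

lemma dome_attach:
  assumes D: "dome T f (a # b # l)" and v: "v \<notin> cx_verts T"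
    and d: "dist (f a) x = 1" "dist x (f b) = 1"
  shows "dome (insert {a, v, b} T) (f(v := x)) (a # v # b # l)"
proof -
  have S: "surface_complex T" and dis: "distinct (a # b # l)" and len: "l \<noteq> []"
    and B: "boundary_edges T = insert {a, b} (path_edges (b # l @ [a]))"
    and eq: "\<And>t a b. t \<in> T \<Longrightarrow> a \<in> t \<Longrightarrow> b \<in> t \<Longrightarrow> a \<noteq> b \<Longrightarrow> dist (f a) (f b) = 1"
    using D by (auto simp: dome_def)
  have ab: "{a, b} \<in> boundary_edges T" using B by simp
  have wv: "set (a # b # l) \<subseteq> cx_verts T" using dome_verts[OF D] by blast
  have va: "v \<noteq> a" "v \<noteq> b" "v \<notin> set l" "a \<noteq> b" using wv v dis by auto
  have nv: "{v, y} \<notin> cx_edges T" "{y, v} \<notin> cx_edges T" for y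
    using v cx_edge_in_verts by blast+
  have abE: "{a, b} \<in> cx_edges T" using ab by (simp add: boundary_edges_def)
  have s: "surface_complex (insert {a, v, b} T)"
    "boundary_edges (insert {a, v, b} T) = (boundary_edges T - Pow {a, v, b}) \<union>
      {e. e \<subseteq> {a, v, b} \<and> card e = 2 \<and> e \<notin> cx_edges T}"
  proof -
    have 1: "card {a, v, b} = 3" using va by auto
    have 2: "e \<in> boundary_edges T \<or> e \<notin> cx_edges T" if "e \<subseteq> {a, v, b}" "card e = 2" for e
      using card_2_subset_triple[OF that] nv ab by auto
    have 3: "\<exists>c\<in>{a, v, b}. {u, c} \<in> boundary_edges T" if "u \<in> {a, v, b}" "u \<in> cx_verts T" for u
      using that ab v by (auto simp: insert_commute)
    note * = surface_complex_insert[OF S 1 2 3 _ _ ab _ _ va(1) nv(1)]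
    show "surface_complex (insert {a, v, b} T)"
      by (rule *(1)) auto
    show "boundary_edges (insert {a, v, b} T) = (boundary_edges T - Pow {a, v, b}) \<union>
      {e. e \<subseteq> {a, v, b} \<and> card e = 2 \<and> e \<notin> cx_edges T}"
      by (rule *(2)) auto
  qed
  have "{e. e \<subseteq> {a, v, b} \<and> card e = 2 \<and> e \<notin> cx_edges T} = {{a, v}, {v, b}}" (is "?X = ?Y")
  proof
    show "?X \<subseteq> ?Y" using card_2_subset_triple[of _ a v b] abE by auto
    show "?Y \<subseteq> ?X" using va nv by auto
  qed
  moreover have "boundary_edges T - Pow {a, v, b} = path_edges (b # l @ [a])"
  proof -
    \<comment> \<open>As \<open>l\<close> is nonempty, every edge of the path from \<open>b\<close>
      through \<open>l\<close> to \<open>a\<close> has an endpoint in \<open>l\<close>, outside the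
      triangle.\<close>
    have "\<not> e \<subseteq> {a, v, b}" if "e \<in> path_edges (b # l @ [a])" for e
    proof -
      obtain c m where l: "l = c # m" using len by (cases l) auto
      have "path_edges (b # l @ [a]) = insert {b, c} (path_edges (l @ [a]))" using l by simp
      moreover have "\<exists>y\<in>set l. y \<in> e" if "e \<in> path_edges (l @ [a])"
        using that by (rule path_edges_meet)
      moreover have "\<exists>y\<in>set l. y \<in> {b, c}" using l by auto
      ultimately show ?thesis using \<open>e \<in> _\<close> va dis by fastforce
    qed
    then show ?thesis using B by auto
  qed
  ultimately have "boundary_edges (insert {a, v, b} T) = path_edges ((a # v # b # l) @ [hd (a # v # b # l)])"
    using s(2) by auto
  moreover have "dist ((f(v := x)) p) ((f(v := x)) q) = 1"
    if "t \<in> insert {a, v, b} T" "p \<in> t" "q \<in> t" "p \<noteq> q" for t p q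
  proof (cases "t \<in> T")
    case True
    then have "p \<noteq> v" "q \<noteq> v" using v that by (auto simp: cx_verts_def)
    then show ?thesis using eq that True by simp
  next
    case False
    obtain s where "s \<in> T" "{a, b} \<subseteq> s" using abE by (auto simp: cx_edges_def)
    then have "dist (f a) (f b) = 1" using eq va by auto
    then show ?thesis using False that d va by (auto simp: dist_commute)
  qed
  ultimately show ?thesis
    using s(1) dis va len unfolding dome_def by (cases l) auto
qed

text \<open>Two boundary edges are used up and \<open>x\<close> becomes interior. If
  \<open>{a, b}\<close> were an edge already, it would be an interior one, with no room for another
  triangle. A nonempty \<open>l\<close> leaves a boundary of at least 3 vertices.\<close>

lemma dome_close:
  assumes D: "dome T f (a # x # b # l)" and len: "l \<noteq> []" and n: "{a, b} \<notin> cx_edges T"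
    and d: "dist (f a) (f b) = 1"
  shows "dome (insert {a, x, b} T) f (a # b # l)"
proof -
  have S: "surface_complex T" and dis: "distinct (a # x # b # l)"
    and B: "boundary_edges T = insert {a, x} (insert {x, b} (path_edges (b # l @ [a])))"
    and eq: "\<And>t a b. t \<in> T \<Longrightarrow> a \<in> t \<Longrightarrow> b \<in> t \<Longrightarrow> a \<noteq> b \<Longrightarrow> dist (f a) (f b) = 1"
    using D by (auto simp: dome_def)
  have bs: "{a, x} \<in> boundary_edges T" "{x, b} \<in> boundary_edges T" using B by auto
  then have es: "{a, x} \<in> cx_edges T" "{x, b} \<in> cx_edges T" by (auto simp: boundary_edges_def)
  have ne: "a \<noteq> x" "x \<noteq> b" "a \<noteq> b" using dis by auto
  have s: "surface_complex (insert {a, x, b} T)"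
    "boundary_edges (insert {a, x, b} T) = (boundary_edges T - Pow {a, x, b}) \<union>
      {e. e \<subseteq> {a, x, b} \<and> card e = 2 \<and> e \<notin> cx_edges T}"
  proof -
    have 1: "card {a, x, b} = 3" using ne by auto
    have 2: "e \<in> boundary_edges T \<or> e \<notin> cx_edges T" if "e \<subseteq> {a, x, b}" "card e = 2" for e
      using card_2_subset_triple[OF that] n bs by auto
    have 3: "\<exists>c\<in>{a, x, b}. {u, c} \<in> boundary_edges T" if "u \<in> {a, x, b}" "u \<in> cx_verts T" for u
      using that bs by (auto simp: insert_commute)
    note * = surface_complex_insert[OF S 1 2 3 _ _ bs(1) _ _ ne(3) n]
    show "surface_complex (insert {a, x, b} T)"
      by (rule *(1)) auto
    show "boundary_edges (insert {a, x, b} T) = (boundary_edges T - Pow {a, x, b}) \<union>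
      {e. e \<subseteq> {a, x, b} \<and> card e = 2 \<and> e \<notin> cx_edges T}"
      by (rule *(2)) auto
  qed
  have "{e. e \<subseteq> {a, x, b} \<and> card e = 2 \<and> e \<notin> cx_edges T} = {{a, b}}" (is "?X = ?Y")
  proof
    show "?X \<subseteq> ?Y" using card_2_subset_triple[of _ a x b] es by auto
    show "?Y \<subseteq> ?X" using ne n by auto
  qed
  moreover have "boundary_edges T - Pow {a, x, b} = path_edges (b # l @ [a])"
  proof -
    \<comment> \<open>The remaining path avoids \<open>x\<close>, so an edge of it inside the
      triangle could only be \<open>{a, b}\<close>, which is not an edge.\<close>
    have "\<not> e \<subseteq> {a, x, b}" if e: "e \<in> path_edges (b # l @ [a])" for e
    proof
      assume sub: "e \<subseteq> {a, x, b}"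
      have "e \<in> boundary_edges T" using e B by auto
      then have "card e = 2" "e \<in> cx_edges T" by (auto simp: boundary_edges_def cx_edges_def)
      moreover have "x \<notin> e" using path_edges_subset[OF e] dis by auto
      ultimately show False using card_2_subset_triple[OF sub] n by auto
    qed
    then show ?thesis using B by auto
  qed
  ultimately have "boundary_edges (insert {a, x, b} T) = path_edges ((a # b # l) @ [hd (a # b # l)])"
    using s(2) by auto
  moreover have "dist (f p) (f q) = 1"
    if "t \<in> insert {a, x, b} T" "p \<in> t" "q \<in> t" "p \<noteq> q" for t p q
  proof (cases "t \<in> T")
    case True
    then show ?thesis using eq that by simp
  next
    case False
    have "dist (f a) (f x) = 1" "dist (f x) (f b) = 1"
      using es eq ne unfolding cx_edges_def by blast+
    then show ?thesis using False that d by (auto simp: dist_commute)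
  qed
  ultimately show ?thesis
    using s(1) dis len unfolding dome_def by (cases l) auto
qed

section \<open>Moves on polygons\<close>

lemma norm_diff_eq_1_iff:
  fixes a b :: "'a::real_inner"
  assumes "norm a = 1" "norm b = 1"
  shows "norm (a - b) = 1 \<longleftrightarrow> a \<bullet> b = 1 / 2"
proof -
  have "a \<bullet> a = 1" "b \<bullet> b = 1" using assms by (auto simp: norm_eq_1)
  then show ?thesis unfolding norm_eq_1 by (auto simp: inner_diff inner_commute)
qed

lemma ex_unit_orthogonal:
  fixes a b :: "real^3"
  obtains m where "norm m = 1" "a \<bullet> m = 0" "b \<bullet> m = 0"
proof -
  have "dim {a, b} \<le> card {a, b}" by (rule dim_le_card') simp
  also have "\<dots> \<le> 2" by (simp add: card_insert_if)
  finally have "dim {a, b} < DIM(real^3)" by simp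
  then obtain x where x: "x \<noteq> 0" "\<And>y. y \<in> span {a, b} \<Longrightarrow> orthogonal x y"
    using orthogonal_to_subspace_exists by blast
  have "a \<bullet> x = 0" "b \<bullet> x = 0"
    using x(2)[of a] x(2)[of b] by (auto simp: span_base orthogonal_def inner_commute)
  then show ?thesis
    using that[of "x /\<^sub>R norm x"] x(1) by simp
qed

text \<open>The apex \<open>m\<close> lies over the bisector of \<open>a\<close> and
  \<open>b\<close>, at angle \<pi>/3 from both; it exists because the angle between \<open>a\<close>
  and \<open>b\<close> is at most 2\<pi>/3.\<close>

lemma ex_unit_triangle_apex:
  fixes a b :: "real^3"
  assumes "norm a = 1" "norm b = 1" "a \<bullet> b \<ge> - 1 / 2"
  obtains m where "norm m = 1" "norm (a - m) = 1" "norm (m - b) = 1"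
proof -
  obtain k where k: "norm k = 1" "a \<bullet> k = 0" "b \<bullet> k = 0"
    using ex_unit_orthogonal .
  define \<rho> where "\<rho> = a \<bullet> b"
  \<comment> \<open>\<open>l\<close> makes \<open>a \<bullet> m\<close> and
    \<open>b \<bullet> m\<close> equal to 1/2. The part of \<open>m\<close> in the span of
    \<open>a\<close> and \<open>b\<close> then has squared norm \<open>l\<close>, which leaves
    \<open>1 - l\<close> for the square of \<open>\<mu>\<close>.\<close>
  define l where "l = 1 / (2 * (1 + \<rho>))"
  define \<mu> where "\<mu> = sqrt (1 - l)"
  have \<rho>: "\<rho> \<ge> - 1/2" using assms by (simp add: \<rho>_def)
  have l: "l * (1 + \<rho>) = 1 / 2" "l \<le> 1" using \<rho> by (auto simp: l_def field_simps)
  have \<mu>: "\<mu> * \<mu> = 1 - l" using l(2) by (simp add: \<mu>_def)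
  define m where "m = l *\<^sub>R (a + b) + \<mu> *\<^sub>R k"
  have aa: "a \<bullet> a = 1" "b \<bullet> b = 1" "k \<bullet> k = 1" using assms k by (auto simp: norm_eq_1)
  have am: "a \<bullet> m = 1/2" "b \<bullet> m = 1/2"
    using l aa k by (auto simp: m_def inner_add \<rho>_def inner_commute[of b a] algebra_simps)
  have "m \<bullet> m = l * (a \<bullet> m + b \<bullet> m) + \<mu> * (k \<bullet> m)"
    by (subst (1) m_def) (simp add: inner_add)
  also have "k \<bullet> m = \<mu>"
    using k aa by (simp add: m_def inner_add inner_commute[of k a] inner_commute[of k b])
  finally have m1: "norm m = 1" using am \<mu> by (simp add: norm_eq_1)
  moreover have "norm (a - m) = 1" "norm (b - m) = 1"
    using norm_diff_eq_1_iff am assms m1 by blast+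
  ultimately show ?thesis
    using that by (simp add: norm_minus_commute)
qed

text \<open>Three unit steps suffice even between antipodal points: the first one brings the angle
  to \<open>b\<close> down to at most 2\<pi>/3, and \<open>ex_unit_triangle_apex\<close> supplies
  the other two.\<close>

lemma ex_three_steps:
  fixes a b :: "real^3"
  assumes a: "norm a = 1" and b: "norm b = 1"
  obtains s1 s2 where "norm s1 = 1" "norm s2 = 1" "norm (a - s1) = 1" "norm (s1 - s2) = 1" "norm (s2 - b) = 1"
proof -
  obtain k where k: "norm k = 1" "a \<bullet> k = 0"
    using ex_unit_orthogonal[of a a] .
  \<comment> \<open>The sign puts \<open>k'\<close> on the side of \<open>b\<close>, so that
    \<open>s1 \<bullet> b\<close> is at least half of \<open>a \<bullet> b\<close>, hence at least
    -1/2.\<close>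
  define k' where "k' = (if b \<bullet> k \<ge> 0 then k else - k)"
  have k': "norm k' = 1" "a \<bullet> k' = 0" "b \<bullet> k' \<ge> 0" using k by (auto simp: k'_def)
  define s1 where "s1 = (1/2) *\<^sub>R a + (sqrt 3 / 2) *\<^sub>R k'"
  have aa: "a \<bullet> a = 1" "k' \<bullet> k' = 1" using a k' by (auto simp: norm_eq_1)
  have as1: "a \<bullet> s1 = 1/2" using aa k' by (simp add: s1_def inner_add)
  have "k' \<bullet> s1 = sqrt 3 / 2" using aa k' by (simp add: s1_def inner_add inner_commute[of k' a])
  then have "s1 \<bullet> s1 = 1" using as1 by (subst (1) s1_def) (simp only: inner_add inner_scaleR_left, simp)
  then have s1: "norm s1 = 1" by (simp add: norm_eq_1)
  have "a \<bullet> b \<ge> -1" using Cauchy_Schwarz_ineq2[of a b] a b by simp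
  then have "s1 \<bullet> b \<ge> - 1 / 2"
    using mult_nonneg_nonneg[OF real_sqrt_ge_zero[of 3] k'(3)]
    by (simp add: s1_def inner_add inner_commute[of k' b])
  then obtain s2 where "norm s2 = 1" "norm (s1 - s2) = 1" "norm (s2 - b) = 1"
    using ex_unit_triangle_apex[OF s1 b] by blast
  then show ?thesis
    using that s1 as1 norm_diff_eq_1_iff[OF a s1] by blast
qed

section \<open>Rotating and changing the boundary polygon\<close>

lemma can_be_domed_rotate: "can_be_domed (xs @ ys) \<Longrightarrow> can_be_domed (ys @ xs)"
proof -
  assume "can_be_domed (xs @ ys)"
  then obtain T f w where D: "dome T f w" "map f w = xs @ ys" by (auto simp: can_be_domed_iff)
  then obtain us vs where "w = us @ vs" "map f us = xs" "map f vs = ys"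
    by (auto simp: map_eq_append_conv)
  then show ?thesis
    using D dome_rotate unfolding can_be_domed_iff by fastforce
qed

lemma can_be_domed_attach:
  assumes "can_be_domed (a # b # l)" "dist a x = 1" "dist x b = 1"
  shows "can_be_domed (a # x # b # l)"
proof -
  obtain T f w where D: "dome T f w" and w: "map f w = a # b # l"
    using assms by (auto simp: can_be_domed_iff)
  then obtain a' b' l' where w': "w = a' # b' # l'" "f a' = a" "f b' = b" "map f l' = l"
    by auto
  obtain v where v: "v \<notin> cx_verts T" using ex_fresh_vertex[OF D] .
  have "dome (insert {a', v, b'} T) (f(v := x)) (a' # v # b' # l')"
    using dome_attach[OF D[unfolded w'(1)] v] assms w' by simp
  moreover have "v \<notin> set w" using dome_verts[OF D] v by blast
  then have "map (f(v := x)) (a' # v # b' # l') = a # x # b # l"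
    using w' by auto
  ultimately show ?thesis unfolding can_be_domed_iff by (intro exI conjI)
qed

text \<open>The triangle with vertices \<open>a, x, b\<close> cannot be glued on directly, since the edge \<open>{a, b}\<close> may
  already be present.  So the boundary vertex \<open>a\<close> is first replaced by a fresh copy \<open>a'\<close>: the two are
  the apexes of a suspension over a path of unit steps, on the unit sphere around \<open>a\<close>, from the
  predecessor of \<open>a\<close> to \<open>x\<close>.\<close>

lemma can_be_domed_close:
  assumes "can_be_domed (c # a # x # b # l)" "dist c a = 1" "dist a x = 1" "dist a b = 1"
  shows "can_be_domed (a # b # l @ [c])"
proof -
  obtain T f w where D: "dome T f w" and w: "map f w = c # a # x # b # l"
    using assms by (auto simp: can_be_domed_iff)
  then obtain c' a' x' b' l' where w': "w = c' # a' # x' # b' # l'"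
    "f c' = c" "f a' = a" "f x' = x" "f b' = b" "map f l' = l"
    by auto
  have "norm (c - a) = 1" "norm (x - a) = 1" using assms by (auto simp: dist_norm norm_minus_commute)
  then obtain u1 u2 where u: "norm u1 = 1" "norm u2 = 1" "norm ((c - a) - u1) = 1" "norm (u1 - u2) = 1"
      "norm (u2 - (x - a)) = 1"
    by (rule ex_three_steps)
  define s1 where "s1 = a + u1"
  define s2 where "s2 = a + u2"
  have s: "dist a s1 = 1" "dist a s2 = 1" "dist c s1 = 1" "dist s1 s2 = 1" "dist s2 x = 1"
    using u by (auto simp: s1_def s2_def dist_norm norm_minus_commute algebra_simps)
  note D0 = D[unfolded w'(1)]
  have dw: "distinct (c' # a' # x' # b' # l')" using D0 by (simp add: dome_def)
  have sv: "set (c' # a' # x' # b' # l') \<subseteq> cx_verts T" using dome_verts[OF D0] by blast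
  obtain v1 where v1: "v1 \<notin> cx_verts T" using ex_fresh_vertex[OF D0] .
  \<comment> \<open>Three triangles around \<open>a'\<close> along the path \<open>c'\<close>,
    \<open>v1\<close>, \<open>v2\<close>, \<open>x'\<close> make \<open>a'\<close> an interior
    vertex.\<close>
  define T1 where "T1 = insert {c', v1, a'} T"
  define f1 where "f1 = f(v1 := s1)"
  have D1: "dome T1 f1 (c' # v1 # a' # x' # b' # l')"
    unfolding T1_def f1_def using dome_attach[OF D0 v1] s w' by (simp add: dist_commute)
  have sv1: "set (c' # v1 # a' # x' # b' # l') \<subseteq> cx_verts T1" using dome_verts[OF D1] by blast
  obtain v2 where v2: "v2 \<notin> cx_verts T1" using ex_fresh_vertex[OF D1] .
  define T2 where "T2 = insert {v1, v2, a'} T1"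
  define f2 where "f2 = f1(v2 := s2)"
  have D2: "dome T2 f2 (v1 # v2 # a' # x' # b' # l' @ [c'])"
    unfolding T2_def f2_def
    using dome_attach[OF dome_rotate1[OF D1, simplified] v2] s w' sv v1 by (auto simp: f1_def dist_commute)
  have f2: "f2 v1 = s1" "f2 v2 = s2" "map f2 (c' # a' # x' # b' # l') = c # a # x # b # l"
    using w' v1 v2 sv sv1 by (auto simp: f1_def f2_def)
  define T3 where "T3 = insert {v2, a', x'} T2"
  have "{v2, x'} \<notin> cx_edges T2"
    using v2 sv1 v1 sv dw unfolding T2_def
    by (auto dest!: cx_edge_insertD dest: cx_edge_in_verts)
  then have "dome T3 f2 (v2 # x' # b' # l' @ [c', v1])"
    unfolding T3_def using dome_close[OF dome_rotate1[OF D2, simplified]] f2 s by auto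
  then have D3: "dome T3 f2 (c' # v1 # v2 # x' # b' # l')"
    using dome_rotate[of T3 f2 "v2 # x' # b' # l'" "[c', v1]"] by simp
  have sv3: "set (c' # v1 # v2 # x' # b' # l') \<subseteq> cx_verts T3" using dome_verts[OF D3] by blast
  \<comment> \<open>The copy \<open>v3\<close> of \<open>a'\<close> is coned over the same path by
    \<open>T4\<close>, \<open>T5\<close> and \<open>T6\<close>. The boundary polygon is then the
    original one again, but \<open>{v3, b'}\<close> is not an edge because \<open>v3\<close> is
    fresh.\<close>
  obtain v3 where v3: "v3 \<notin> cx_verts T3" using ex_fresh_vertex[OF D3] .
  define T4 where "T4 = insert {c', v3, v1} T3"
  define g where "g = f2(v3 := a)"
  have g: "g v1 = s1" "g v2 = s2" "g v3 = a" "map g (c' # x' # b' # l') = c # x # b # l"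
    using f2 v3 sv3 by (auto simp: g_def)
  have dd: "distinct (c' # v1 # v2 # x' # b' # l')" using D3 by (simp add: dome_def)
  have D4: "dome T4 g (c' # v3 # v1 # v2 # x' # b' # l')"
    unfolding T4_def g_def using dome_attach[OF D3 v3] s f2 assms by (simp add: dist_commute)
  have fresh: "{v3, y} \<notin> cx_edges T3" for y using v3 cx_edge_in_verts by blast
  define T5 where "T5 = insert {v3, v1, v2} T4"
  have "{v3, v2} \<notin> cx_edges T4"
    using v3 sv3 dd fresh unfolding T4_def by (auto dest!: cx_edge_insertD)
  then have D5: "dome T5 g (v3 # v2 # x' # b' # l' @ [c'])"
    unfolding T5_def using dome_close[OF dome_rotate1[OF D4, simplified]] g s by auto
  define T6 where "T6 = insert {v3, v2, x'} T5"
  have "{v3, x'} \<notin> cx_edges T5"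
    using v3 sv3 dd fresh unfolding T5_def T4_def by (auto dest!: cx_edge_insertD)
  then have D6: "dome T6 g (v3 # x' # b' # l' @ [c'])"
    unfolding T6_def using dome_close[OF D5] g assms by auto
  have "{v3, b'} \<notin> cx_edges T6"
    using v3 sv3 dd fresh unfolding T6_def T5_def T4_def by (auto dest!: cx_edge_insertD)
  then have "dome (insert {v3, x', b'} T6) g (v3 # b' # l' @ [c'])"
    using dome_close[OF D6] g assms by auto
  then show ?thesis
    unfolding can_be_domed_iff using g by (intro exI conjI) auto
qed

lemma can_be_domed_triangle:
  assumes "dist a b = 1" "dist b c = 1" "dist c a = 1"
  shows "can_be_domed [a, b, c]"
proof -
  define T where "T = {{0, 1, 2 :: nat}}"
  define f where "f = (\<lambda>i::nat. if i = 0 then a else if i = 1 then b else c)"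
  have E: "cx_edges T = {{0, 1}, {1, 2}, {2, 0}}" (is "_ = ?R")
  proof
    show "cx_edges T \<subseteq> ?R"
      using card_2_subset_triple[of _ "0::nat" 1 2] by (auto simp: cx_edges_def T_def)
    show "?R \<subseteq> cx_edges T" by (auto simp: cx_edges_def T_def)
  qed
  have count: "edge_count T e = 1" if "e \<in> cx_edges T" for e
  proof -
    have "{t \<in> T. e \<subseteq> t} = {{0, 1, 2}}" using that E by (auto simp: T_def)
    then show ?thesis by (simp add: edge_count_def)
  qed
  have V: "cx_verts T = {0, 1, 2}" by (simp add: cx_verts_def T_def)
  have "surface_complex T"
    unfolding surface_complex_def
  proof (intro conjI ballI allI impI)
    fix v x y assume v: "v \<in> cx_verts T" "{v, x} \<in> cx_edges T" "{v, y} \<in> cx_edges T"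
    then have s: "{v, x, y} \<subseteq> {0, 1, 2}" and ne: "v \<noteq> x" "v \<noteq> y"
      by (auto simp: cx_edges_def T_def)
    have "x = y \<or> {v, x, y} \<in> T"
      using card_subset_eq[OF _ s] ne by (cases "x = y") (simp_all add: T_def)
    then show "(\<lambda>x y. {v, x, y} \<in> T)\<^sup>*\<^sup>* x y" by auto
  next
    fix x y assume "x \<in> cx_verts T" "y \<in> cx_verts T"
    then have "x = y \<or> {x, y} \<in> cx_edges T" unfolding V by (auto simp: cx_edges_def T_def)
    then show "(\<lambda>x y. {x, y} \<in> cx_edges T)\<^sup>*\<^sup>* x y" by auto
  qed (use count in \<open>auto simp: T_def\<close>)
  moreover have "boundary_edges T = cx_edges T"
    using count by (auto simp: boundary_edges_def)
  then have "boundary_edges T = path_edges ([0, 1, 2] @ [hd [0, 1, 2]])"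
    by (simp add: E)
  moreover have "dist (f x) (f y) = 1" if "x \<in> {0, 1, 2}" "y \<in> {0, 1, 2}" "x \<noteq> y" for x y
    using that assms dist_commute[of a b] dist_commute[of b c] dist_commute[of c a] by (auto simp: f_def)
  ultimately have "dome T f [0, 1, 2]"
    unfolding dome_def by (simp add: T_def)
  then show ?thesis
    unfolding can_be_domed_iff by (intro exI conjI) (auto simp: f_def)
qed

section \<open>Words of unit vectors\<close>

text \<open>The end point is left out: for a closed word it is the starting point again.\<close>

fun walk :: "'a::ab_group_add \<Rightarrow> 'a list \<Rightarrow> 'a list" where
  "walk u [] = []"
| "walk u (v # vs) = u # walk (u + v) vs"

lemma walk_append: "walk u (xs @ ys) = walk u xs @ walk (u + sum_list xs) ys"
  by (induction xs arbitrary: u) (auto simp: add.assoc)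

lemma length_walk [simp]: "length (walk u xs) = length xs"
  by (induction xs arbitrary: u) auto

text \<open>All starting points \<open>u\<close> are included, since rotating a word moves its
  starting point.\<close>

definition domed_word :: "(real^3) list \<Rightarrow> bool" where
  "domed_word ws \<longleftrightarrow> sum_list ws = 0 \<and> (\<forall>v\<in>set ws. norm v = 1) \<and> (\<forall>u. can_be_domed (walk u ws))"

lemma domed_word_length:
  assumes "domed_word ws"
  shows "length ws \<ge> 3"
proof -
  obtain T f w where "dome T f w" "map f w = walk 0 ws"
    using assms unfolding domed_word_def can_be_domed_iff by blast
  then show ?thesis
    unfolding dome_def by (metis length_map length_walk)
qed

lemma domed_word_rotate:
  assumes "domed_word (xs @ ys)"
  shows "domed_word (ys @ xs)"
proof -
  have s: "sum_list xs + sum_list ys = 0" using assms by (simp add: domed_word_def)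
  have "can_be_domed (walk u (ys @ xs))" for u
  proof -
    have "can_be_domed (walk (u + sum_list ys) xs @ walk (u + sum_list ys + sum_list xs) ys)"
      using assms unfolding domed_word_def by (metis walk_append)
    moreover have "u + sum_list ys + sum_list xs = u" using s by (simp add: algebra_simps)
    ultimately show ?thesis
      by (metis can_be_domed_rotate walk_append)
  qed
  then show ?thesis using assms by (auto simp: domed_word_def add.commute)
qed

lemma domed_word_split_letter:
  assumes D: "domed_word (xs @ [p + q] @ ys)" and n: "norm p = 1" "norm q = 1"
  shows "domed_word (xs @ [p, q] @ ys)"
proof -
  have D': "domed_word ((p + q) # ys @ xs)"
    using domed_word_rotate[OF D] by simp
  obtain y zs where y: "ys @ xs = y # zs"
    using domed_word_length[OF D] by (cases "ys @ xs") auto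
  have "can_be_domed (walk u (p # q # ys @ xs))" for u
    using D' n can_be_domed_attach[of u "u + (p + q)" "walk (u + (p + q) + y) zs" "u + p"]
    unfolding y domed_word_def by (auto simp: dist_norm add.assoc)
  then have "domed_word ((p # q # ys) @ xs)"
    using D' n by (auto simp: domed_word_def add.assoc)
  then show ?thesis
    using domed_word_rotate[of "p # q # ys" xs] by simp
qed

text \<open>This closes the corner between \<open>p\<close> and \<open>q\<close> by
  \<open>can_be_domed_close\<close>. The bound on the context provides the preceding letter
  \<open>z\<close> and a further letter \<open>y\<close>, so that at least three letters
  remain.\<close>

lemma domed_word_merge_letters:
  assumes D: "domed_word (xs @ [p, q] @ ys)" and n: "norm (p + q) = 1" and len: "length (xs @ ys) \<ge> 2"
  shows "domed_word (xs @ [p + q] @ ys)"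
proof -
  have "ys @ xs \<noteq> []" using len by auto
  then obtain zs z where z: "ys @ xs = zs @ [z]" by (metis rev_exhaust)
  have "length (ys @ xs) = length zs + 1" by (simp only: z length_append) simp
  then have "zs \<noteq> []" using len by auto
  then obtain y vs where y: "zs = y # vs" by (cases zs) auto
  have D1: "domed_word ([p, q] @ ys @ xs)"
    using domed_word_rotate[OF D] by simp
  then have D2: "domed_word (z # p # q # y # vs)"
    using domed_word_rotate[of "[p, q] @ zs" "[z]"] z y by simp
  then have s: "z + p + q + y + sum_list vs = 0" and nn: "norm z = 1" "norm p = 1" "norm q = 1"
    by (auto simp: domed_word_def add.assoc)
  have n': "norm (q + p) = 1" using n by (simp add: add.commute)
  have "can_be_domed (walk u ((p + q) # y # vs @ [z]))" for u
  proof -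
    have "can_be_domed (walk (u - z) (z # p # q # y # vs))"
      using D2 unfolding domed_word_def by blast
    then have "can_be_domed (u # (u + p + q) # walk (u + p + q + y) vs @ [u - z])"
      using can_be_domed_close[of "u - z" u "u + p" "u + p + q"] n n' nn
      by (simp add: dist_norm norm_minus_commute add.assoc)
    moreover have "u - z = u + p + q + y + sum_list vs"
      using s by (simp add: algebra_simps add_eq_0_iff2)
    ultimately show ?thesis
      by (simp add: walk_append add.assoc)
  qed
  then have "domed_word ((p + q) # ys @ xs)"
    using D1 n z y by (auto simp: domed_word_def add.assoc)
  then show ?thesis
    using domed_word_rotate[of "(p + q) # ys" xs] by simp
qed

section \<open>Magnified words and local rewriting\<close>

definition blow_up :: "nat \<Rightarrow> 'a list \<Rightarrow> 'a list" where
  "blow_up r ws = concat (map (replicate r) ws)"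

lemma blow_up_append [simp]: "blow_up r (xs @ ys) = blow_up r xs @ blow_up r ys"
  and blow_up_Cons [simp]: "blow_up r (x # xs) = replicate r x @ blow_up r xs"
  and blow_up_Nil [simp]: "blow_up r [] = []"
  by (simp_all add: blow_up_def)

lemma length_blow_up: "length (blow_up r ws) = r * length ws"
  by (induction ws) auto

lemma blow_up_1 [simp]: "blow_up (Suc 0) ws = ws"
  by (induction ws) auto

text \<open>A rewriting rule that may be applied inside the word of any polygon magnified by
  \<open>r\<close>. The bound on the context is the one that merging two letters requires.\<close>

definition reduces :: "nat \<Rightarrow> (real^3) list \<Rightarrow> (real^3) list \<Rightarrow> bool" where
  "reduces r xs ys \<longleftrightarrow> (\<forall>as bs. length (as @ bs) \<ge> 2 \<longrightarrow>
     domed_word (blow_up r (as @ xs @ bs)) \<longrightarrow> domed_word (blow_up r (as @ ys @ bs)))"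

lemma reducesD:
  "reduces r xs ys \<Longrightarrow> domed_word (blow_up r (as @ xs @ bs)) \<Longrightarrow> length (as @ bs) \<ge> 2 \<Longrightarrow>
    domed_word (blow_up r (as @ ys @ bs))"
  unfolding reduces_def by blast

lemma reduces_refl: "reduces r xs xs"
  by (simp add: reduces_def)

lemma reduces_trans [trans]: "reduces r xs ys \<Longrightarrow> reduces r ys zs \<Longrightarrow> reduces r xs zs"
  unfolding reduces_def by blast

lemma reduces_context: 
  assumes "reduces r xs ys"
  shows "reduces r (as @ xs @ bs) (as @ ys @ bs)"
  unfolding reduces_def
proof (intro allI impI)
  fix cs ds
  assume "length (cs @ ds) \<ge> 2" "domed_word (blow_up r (cs @ (as @ xs @ bs) @ ds))"
  then show "domed_word (blow_up r (cs @ (as @ ys @ bs) @ ds))"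
    using reducesD[OF assms, of "cs @ as" "bs @ ds"] by simp
qed

lemma reduces_left: "reduces r xs ys \<Longrightarrow> reduces r (xs @ bs) (ys @ bs)"
  using reduces_context[of r xs ys "[]" bs] by simp

lemma reduces_right: "reduces r xs ys \<Longrightarrow> reduces r (as @ xs) (as @ ys)"
  using reduces_context[of r xs ys as "[]"] by simp

lemma reduces_split_1: "norm p = 1 \<Longrightarrow> norm q = 1 \<Longrightarrow> reduces 1 [p + q] [p, q]"
  unfolding reduces_def using domed_word_split_letter by simp

lemma reduces_merge_1: "norm (p + q) = 1 \<Longrightarrow> reduces 1 [p, q] [p + q]"
  unfolding reduces_def using domed_word_merge_letters by simp

text \<open>A flip across a rhombus of two unit triangles: merge, then split in the other
  order.\<close>

lemma reduces_commute:
  assumes "norm p = 1" "norm q = 1" "norm (p + q) = 1"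
  shows "reduces 1 [p, q] [q, p]"
  using reduces_trans[OF reduces_merge_1[of p q] reduces_split_1[of q p, unfolded add.commute[of q p]]] assms
  by blast

lemma reduces_commute_left:
  assumes "norm p = 1" "norm q = 1" "norm (p + q) = 1"
  shows "reduces 1 (replicate k p @ [q]) (q # replicate k p)"
proof (induction k)
  case (Suc k)
  have "reduces 1 (p # replicate k p @ [q]) (p # q # replicate k p)"
    using reduces_right[OF Suc, of "[p]"] by simp
  also have "reduces 1 \<dots> (q # p # replicate k p)"
    using reduces_left[OF reduces_commute[OF assms], of "replicate k p"] by simp
  finally show ?case by simp
qed (simp add: reduces_refl)

lemma reduces_commute_right:
  assumes "norm p = 1" "norm q = 1" "norm (p + q) = 1"
  shows "reduces 1 (q # replicate k p) (replicate k p @ [q])"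
proof (induction k)
  case (Suc k)
  have "reduces 1 (q # p # replicate k p) (p # q # replicate k p)"
    using reduces_left[OF reduces_commute[of q p], of "replicate k p"] assms by (simp add: add.commute)
  also have "reduces 1 \<dots> (p # replicate k p @ [q])"
    using reduces_right[OF Suc, of "[p]"] by simp
  finally show ?case by simp
qed (simp add: reduces_refl)

text \<open>A blown-up context is itself a context for unit letters, and no shorter.\<close>

lemma reduces_blow_up:
  assumes r: "r \<ge> 1" and "reduces 1 (blow_up r xs) (blow_up r ys)"
  shows "reduces r xs ys"
  unfolding reduces_def
proof (intro allI impI)
  fix as bs assume l: "length (as @ bs) \<ge> 2" and D: "domed_word (blow_up r (as @ xs @ bs))"
  have "length (as @ bs) \<le> r * length (as @ bs)" using r by (metis le_refl mult_1 mult_le_mono1)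
  then have "length (blow_up r as @ blow_up r bs) \<ge> 2"
    using l by (simp add: length_blow_up distrib_left)
  then show "domed_word (blow_up r (as @ ys @ bs))"
    using reducesD[OF assms(2), of "blow_up r as" "blow_up r bs"] D by simp
qed

text \<open>A triangle of side \<open>k + 1\<close> consists of one unit triangle, a triangle of
  side \<open>k\<close>, and a strip of \<open>k\<close> rhombi between them, which carries
  \<open>q\<close> past the letters \<open>p\<close>.\<close>

lemma reduces_split:
  assumes "r \<ge> 1" "norm p = 1" "norm q = 1" "norm (p + q) = 1"
  shows "reduces r [p + q] [p, q]"
proof -
  have "reduces 1 (replicate k (p + q)) (replicate k p @ replicate k q)" for k
  proof (induction k)
    case (Suc k)
    have "reduces 1 ((p + q) # replicate k (p + q)) (p # q # replicate k (p + q))"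
      using reduces_left[OF reduces_split_1[of p q]] assms by force
    also have "reduces 1 \<dots> (p # q # replicate k p @ replicate k q)"
      using reduces_right[OF Suc, of "[p, q]"] by simp
    also have "reduces 1 \<dots> (p # replicate k p @ [q] @ replicate k q)"
      using reduces_context[OF reduces_commute_right[of p q k], of "[p]" "replicate k q"] assms by simp
    finally show ?case by simp
  qed (simp add: reduces_refl)
  then show ?thesis using reduces_blow_up[OF assms(1)] by simp
qed

lemma reduces_merge:
  assumes "r \<ge> 1" "norm p = 1" "norm q = 1" "norm (p + q) = 1"
  shows "reduces r [p, q] [p + q]"
proof -
  have "reduces 1 (replicate k p @ replicate k q) (replicate k (p + q))" for k
  proof (induction k)
    case (Suc k)
    have "reduces 1 (p # replicate k p @ [q] @ replicate k q) (p # q # replicate k p @ replicate k q)"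
      using reduces_context[OF reduces_commute_left[of p q k], of "[p]" "replicate k q"] assms by simp
    also have "reduces 1 \<dots> (p # q # replicate k (p + q))"
      using reduces_right[OF Suc, of "[p, q]"] by simp
    also have "reduces 1 \<dots> ((p + q) # replicate k (p + q))"
      using reduces_left[OF reduces_merge_1[of p q]] assms by force
    finally show ?case by simp
  qed (simp add: reduces_refl)
  then show ?thesis using reduces_blow_up[OF assms(1)] by simp
qed

text \<open>Two triangles share the edge \<open>p - p'\<close>: \<open>p\<close> splits into
  \<open>p'\<close> and \<open>p - p'\<close>, and the latter merges with \<open>q\<close>.\<close>

lemma reduces_flip:
  assumes "r \<ge> 1" "norm p = 1" "norm q = 1" "norm p' = 1" "norm q' = 1"
    "p + q = p' + q'" "norm (p - p') = 1"
  shows "reduces r [p, q] [p', q']"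
proof -
  have q': "(p - p') + q = q'" using assms(6) by (simp add: algebra_simps)
  have "reduces r [p, q] [p', p - p', q]"
    using reduces_left[OF reduces_split[of r p' "p - p'"], of "[q]"] assms by simp
  also have "reduces r \<dots> [p', q']"
    using reduces_right[OF reduces_merge[of r "p - p'" q], of "[p']"] assms q' by simp
  finally show ?thesis .
qed

text \<open>The spike \<open>p, - p\<close> swings to any other direction in three flips, along a
  path of unit steps on the sphere.\<close>

lemma reduces_turn:
  assumes "r \<ge> 1" "norm p = 1" "norm p' = 1"
  shows "reduces r [p, - p] [p', - p']"
proof -
  obtain s1 s2 where s: "norm s1 = 1" "norm s2 = 1" "norm (p - s1) = 1" "norm (s1 - s2) = 1" "norm (s2 - p') = 1"
    using ex_three_steps[OF assms(2,3)] .
  have "reduces r [p, - p] [s1, - s1]" using reduces_flip s assms by simp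
  also have "reduces r \<dots> [s2, - s2]" using reduces_flip s assms by simp
  also have "reduces r \<dots> [p', - p']" using reduces_flip s assms by simp
  finally show ?thesis .
qed

text \<open>Splitting \<open>y\<close> into \<open>m\<close> and \<open>y - m\<close>, and then
  \<open>y - m\<close> into \<open>- m\<close> and \<open>y\<close>, leaves a spike in direction
  \<open>m\<close>, which is turned to \<open>p\<close>.\<close>

lemma reduces_insert:
  assumes "r \<ge> 1" "norm p = 1" "norm y = 1"
  shows "reduces r [y] [p, - p, y]"
proof -
  have "y \<bullet> y \<ge> - 1 / 2" using inner_ge_zero[of y] by linarith
  then obtain m where m: "norm m = 1" "norm (y - m) = 1"
    using ex_unit_triangle_apex[OF assms(3,3)] by blast
  have "reduces r [y] [m, y - m]"
    using reduces_split[of r m "y - m"] m assms by simp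
  also have "reduces r \<dots> [m, - m, y]"
    using reduces_right[OF reduces_split[of r "- m" y], of "[m]"] m assms by simp
  also have "reduces r \<dots> [p, - p, y]"
    using reduces_left[OF reduces_turn[of r m p], of "[y]"] m assms by simp
  finally show ?thesis .
qed

text \<open>Different letters commute, because the sum of two of them is minus the third. The step
  to side \<open>k + 1\<close> expands one \<open>c\<close> so that one more \<open>a\<close>,
  \<open>b\<close> and \<open>c\<close> appear, and then sorts the cyclic word.\<close>

lemma domed_word_blow_up_triangle:
  assumes a: "norm a = 1" and b: "norm b = 1" and c: "norm c = 1" and s: "a + b + c = 0"
    and "r \<ge> 1"
  shows "domed_word (blow_up r [a, b, c])"
  using \<open>r \<ge> 1\<close>
proof (induction r rule: dec_induct)
  case base
  have "can_be_domed (walk u [a, b, c])" for u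
    using can_be_domed_triangle[of u "u + a" "u + a + b"] assms
    by (simp add: dist_norm add_eq_0_iff2)
  then show ?case using assms by (auto simp: domed_word_def add.assoc)
next
  case (step k)
  let ?p = "\<lambda>x. replicate k x"
  have bc: "b + c = - a" "a + b = - c"
    using s by (simp_all add: eq_neg_iff_add_eq_0 ac_simps)
  then have ab: "norm (a + b) = 1" "norm (b + c) = 1" "norm (b + a) = 1" "norm (c + b) = 1"
    using a c by (simp_all add: add.commute)
  obtain j where k: "k = Suc j" using step by (cases k) auto
  have "reduces 1 [c] [a, - a, c]" using reduces_insert a c by simp
  also have "reduces 1 \<dots> [a, b, c, c]"
    using reduces_context[OF reduces_split_1[OF b c], of "[a]" "[c]"] by (simp add: bc)
  finally have "reduces 1 (?p c) (a # b # c # ?p c)"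
    using reduces_left[of 1 "[c]" "[a, b, c, c]" "replicate j c"] by (simp add: k)
  also have "reduces 1 \<dots> (a # c # ?p c @ [b])"
    using reduces_right[OF reduces_commute_right[of c b "Suc k"], of "[a]"] ab b c by simp
  finally have "domed_word (blow_up 1 ((?p a @ ?p b) @ (a # c # ?p c @ [b]) @ []))"
    by (rule reducesD) (use step k in simp_all)
  then have "domed_word (blow_up 1 ([] @ (b # ?p a) @ ?p b @ a # c # ?p c))"
    using domed_word_rotate[of "?p a @ ?p b @ a # c # ?p c" "[b]"] by simp
  then have "domed_word (blow_up 1 ([] @ (?p a @ [b]) @ ?p b @ a # c # ?p c))"
    by (rule reducesD[OF reduces_commute_right, rotated 3]) (use ab a b k in simp_all)
  then have "domed_word (blow_up 1 (?p a @ (replicate (Suc k) b @ [a]) @ c # ?p c))"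
    by simp
  then have "domed_word (blow_up 1 (?p a @ (a # replicate (Suc k) b) @ c # ?p c))"
    by (rule reducesD[OF reduces_commute_left, rotated 3]) (use ab a b k in simp_all)
  then show ?case
    by (simp add: replicate_app_Cons_same)
qed

text \<open>Spikes are inserted one at a time. The initial two come from a triangle with one side
  split: \<open>m, p - m, m - p, - m\<close> is cyclically a pair of spikes, which are turned to the
  wanted directions.\<close>

lemma domed_word_star:
  assumes r: "r \<ge> 1" and "length ps \<ge> 2" "\<And>p. p \<in> set ps \<Longrightarrow> norm p = 1"
  shows "domed_word (blow_up r (concat (map (\<lambda>p. [p, - p]) ps)))"
  using assms(2,3)
proof (induction ps)
  case (Cons p ps)
  show ?case
  proof (cases "length ps \<ge> 2")
    case True
    then obtain q qs where ps: "ps = q # qs" by (cases ps) auto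
    then have "domed_word (blow_up r ([] @ [q] @ (- q) # concat (map (\<lambda>p. [p, - p]) qs)))"
      using Cons True by simp
    then have "domed_word (blow_up r ([] @ [p, - p, q] @ (- q) # concat (map (\<lambda>p. [p, - p]) qs)))"
      by (rule reducesD[OF reduces_insert, rotated 3]) (use Cons True ps r in \<open>auto simp: Suc_le_eq\<close>)
    then show ?thesis using ps by simp
  next
    case False
    then obtain q where ps: "ps = [q]"
      using Cons(2) by (cases ps) (auto simp: not_le)
    have pq: "norm p = 1" "norm q = 1" using Cons ps by auto
    have "p \<bullet> p \<ge> - 1 / 2" using inner_ge_zero[of p] by linarith
    then obtain m where m: "norm m = 1" "norm (p - m) = 1"
      using ex_unit_triangle_apex[OF pq(1,1)] by blast
    have "domed_word (blow_up r ([m, p - m] @ [- p] @ []))"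
      using domed_word_blow_up_triangle[of m "p - m" "- p"] m pq r by simp
    moreover have "reduces r [- p] [m - p, - m]"
      using reduces_split[of r "m - p" "- m"] m pq r by (simp add: norm_minus_commute)
    ultimately have "domed_word (blow_up r ([m, p - m] @ [m - p, - m] @ []))"
      using reducesD by fastforce
    then have "domed_word (blow_up r ([] @ [- m, - (- m)] @ [p - m, - (p - m)]))"
      using domed_word_rotate[of "blow_up r [m, p - m, m - p]" "blow_up r [- m]"] by simp
    then have "domed_word (blow_up r ([] @ [p, - p] @ [p - m, - (p - m)]))"
      by (rule reducesD[OF reduces_turn, rotated 3]) (use m pq r in auto)
    then have "domed_word (blow_up r ([p, - p] @ [p - m, - (p - m)] @ []))"
      by simp
    then have "domed_word (blow_up r ([p, - p] @ [q, - q] @ []))"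
      by (rule reducesD[OF reduces_turn, rotated 3]) (use m pq r in auto)
    then show ?thesis using ps by simp
  qed
qed simp

section \<open>Rings around an axis\<close>

text \<open>Blocks are rewritten from left to right; the other \<open>n - 1\<close> blocks are
  nonempty and so form a context of at least 2 letters.\<close>

lemma domed_word_concat_reduces:
  assumes red: "\<And>i. i < n \<Longrightarrow> reduces r (xs i) (ys i)"
    and ne: "\<And>i. i < n \<Longrightarrow> xs i \<noteq> []" "\<And>i. i < n \<Longrightarrow> ys i \<noteq> []"
    and n: "n \<ge> 3"
    and D: "domed_word (blow_up r (concat (map xs [0..<n])))"
  shows "domed_word (blow_up r (concat (map ys [0..<n])))"
proof -
  have len: "length (concat (map zs [i..<j])) \<ge> j - i"
    if "\<And>k. i \<le> k \<Longrightarrow> k < j \<Longrightarrow> zs k \<noteq> []" for i j and zs :: "nat \<Rightarrow> (real^3) list"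
    using that
  proof (induction j)
    case (Suc j)
    show ?case
    proof (cases "i \<le> j")
      case True
      then have "length (zs j) \<ge> 1" using Suc(2)[of j] by (simp add: Suc_le_eq)
      then show ?thesis using Suc True by simp
    qed simp
  qed simp
  have "domed_word (blow_up r (concat (map ys [0..<j]) @ concat (map xs [j..<n])))" if "j \<le> n" for j
    using that
  proof (induction j)
    case (Suc j)
    have "domed_word (blow_up r (concat (map ys [0..<j]) @ xs j @ concat (map xs [Suc j..<n])))"
      using Suc by (simp add: upt_conv_Cons)
    moreover have "j - 0 \<le> length (concat (map ys [0..<j]))" 
      "n - Suc j \<le> length (concat (map xs [Suc j..<n]))"
      using len[of 0 j ys] len[of "Suc j" n xs] Suc ne by simp_all
    then have "length (concat (map ys [0..<j]) @ concat (map xs [Suc j..<n])) \<ge> 2"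
      using n Suc by simp
    ultimately show ?case
      using reducesD[OF red, of j "concat (map ys [0..<j])" "concat (map xs [Suc j..<n])"] Suc by simp
  qed (use D in simp)
  from this[of n] show ?thesis by simp
qed

text \<open>Rotation by one letter regroups the pairs. In a zigzag word, pairs centred at vertices
  of one ring become pairs centred at vertices of the other.\<close>

lemma domed_word_shift_pairs:
  assumes D: "domed_word (blow_up r (concat (map (\<lambda>i. [f i, g i]) [0..<n])))" and "f n = f 0" and "n > 0"
  shows "domed_word (blow_up r (concat (map (\<lambda>i. [g i, f (Suc i)]) [0..<n])))"
proof -
  have "f 0 # concat (map (\<lambda>i. [g i, f (Suc i)]) [0..<k]) =
      concat (map (\<lambda>i. [f i, g i]) [0..<k]) @ [f k]" for k
    by (induction k) auto
  note * = this[of n]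
  obtain l where l: "concat (map (\<lambda>i. [f i, g i]) [0..<n]) = f 0 # l"
    using \<open>n > 0\<close> by (simp add: upt_conv_Cons)
  have "concat (map (\<lambda>i. [g i, f (Suc i)]) [0..<n]) = l @ [f 0]"
    using * assms(2) unfolding l by simp
  moreover have "domed_word (blow_up r (l @ [f 0]))"
    using D domed_word_rotate[of "blow_up r [f 0]" "blow_up r l"] unfolding l by simp
  ultimately show ?thesis by simp
qed

lemma norm_eq_1_if_square: "(norm x)\<^sup>2 = 1 \<Longrightarrow> norm x = 1"
  using power2_eq_imp_eq[of "norm x" 1] by simp

section \<open>Rings and the distances between them\<close>

locale ring_frame =
  fixes n r :: nat and e1 e2 e3 :: "real^3"
  assumes n3: "n \<ge> 3" and r1: "r \<ge> 1"
    and e: "e1 \<bullet> e1 = 1" "e2 \<bullet> e2 = 1" "e3 \<bullet> e3 = 1" "e1 \<bullet> e2 = 0" "e1 \<bullet> e3 = 0" "e2 \<bullet> e3 = 0"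
begin

definition \<delta> :: real where "\<delta> = pi / n"

text \<open>A ring is a regular \<open>n\<close>-gon around the axis spanned by \<open>e3\<close>; it is encoded by the complex
  number whose real part is its (signed) radius and whose imaginary part is its height.\<close>

definition vertex :: "complex \<Rightarrow> real \<Rightarrow> real^3" where
  "vertex q \<theta> = (Re q * cos \<theta>) *\<^sub>R e1 + (Re q * sin \<theta>) *\<^sub>R e2 + Im q *\<^sub>R e3"

text \<open>The midpoint of two adjacent vertices of the ring, in the plane through the axis at the
  angle halfway between them.\<close>

definition mid :: "complex \<Rightarrow> complex" where
  "mid q = Complex (cos \<delta> * Re q) (Im q)"

text \<open>Counted in half steps, so that the two rings of a zigzag use opposite parities of
  \<open>m\<close>.\<close>

definition angle :: "real \<Rightarrow> nat \<Rightarrow> real" where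
  "angle \<phi> m = \<phi> + real m * \<delta>"

definition zigzag :: "complex \<Rightarrow> complex \<Rightarrow> real \<Rightarrow> (real^3) list" where
  "zigzag q q' \<phi> = concat (map (\<lambda>i.
     [vertex q' (angle \<phi> (2 * i + 1)) - vertex q (angle \<phi> (2 * i)),
      vertex q (angle \<phi> (2 * i + 2)) - vertex q' (angle \<phi> (2 * i + 1))]) [0..<n])"

text \<open>Pythagoras with the right angle at the midpoint of a side of \<open>q'\<close>: up to
  sign \<open>Re q' * sin \<delta>\<close> is half the side, so a vertex of \<open>q\<close> has
  distance 1 from both ends of the side.\<close>

definition unit_gap :: "complex \<Rightarrow> complex \<Rightarrow> bool" where
  "unit_gap q q' \<longleftrightarrow> (cmod (q - mid q'))\<^sup>2 + (Re q' * sin \<delta>)\<^sup>2 = 1"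

lemma \<delta>_pos: "0 < \<delta>" "\<delta> \<le> pi / 3" and n_\<delta>: "real n * \<delta> = pi"
  using n3 by (auto simp: \<delta>_def field_simps)

lemma sin_\<delta>: "sin \<delta> > 0" and cos_\<delta>: "cos \<delta> > 0"
proof -
  have "\<delta> < pi" "\<delta> < pi / 2" using \<delta>_pos pi_gt_zero by linarith+
  then show "sin \<delta> > 0" "cos \<delta> > 0" using \<delta>_pos by (auto intro!: sin_gt_zero cos_gt_zero)
qed

lemma angle_Suc: "angle \<phi> (Suc m) = angle \<phi> m + \<delta>" "angle (\<phi> + \<delta>) m = angle \<phi> (Suc m)"
  by (auto simp: angle_def algebra_simps)

lemma vertex_angle_periodic: "vertex q (angle \<phi> (2 * n + m)) = vertex q (angle \<phi> m)"
proof -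
  have "angle \<phi> (2 * n + m) = angle \<phi> m + 2 * pi"
    using n_\<delta> by (simp add: angle_def algebra_simps)
  then show ?thesis by (simp add: vertex_def)
qed

lemma norm_vertex_diff:
  "(norm (vertex q \<theta> - vertex q' \<theta>'))\<^sup>2 =
    (Re q)\<^sup>2 + (Re q')\<^sup>2 - 2 * Re q * Re q' * cos (\<theta> - \<theta>') + (Im q - Im q')\<^sup>2"
proof -
  define x where "x = Re q * cos \<theta> - Re q' * cos \<theta>'"
  define y where "y = Re q * sin \<theta> - Re q' * sin \<theta>'"
  define z where "z = Im q - Im q'"
  have v: "vertex q \<theta> - vertex q' \<theta>' = x *\<^sub>R e1 + y *\<^sub>R e2 + z *\<^sub>R e3"
    by (simp add: vertex_def x_def y_def z_def algebra_simps)
  have "(norm (vertex q \<theta> - vertex q' \<theta>'))\<^sup>2 = x\<^sup>2 + y\<^sup>2 + z\<^sup>2"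
    unfolding v power2_norm_eq_inner using e by (simp add: inner_add inner_commute[of e2 e1] inner_commute[of e3 e1]
      inner_commute[of e3 e2] power2_eq_square)
  also have "x\<^sup>2 + y\<^sup>2 = (Re q)\<^sup>2 * ((sin \<theta>)\<^sup>2 + (cos \<theta>)\<^sup>2) + (Re q')\<^sup>2 * ((sin \<theta>')\<^sup>2 + (cos \<theta>')\<^sup>2)
      - 2 * Re q * Re q' * cos (\<theta> - \<theta>')"
    unfolding x_def y_def cos_diff by algebra
  finally show ?thesis by (simp add: z_def)
qed

lemma norm_vertex_same_angle: "norm (vertex q \<theta> - vertex q' \<theta>) = cmod (q - q')"
proof -
  have "(norm (vertex q \<theta> - vertex q' \<theta>))\<^sup>2 = (cmod (q - q'))\<^sup>2"
    unfolding norm_vertex_diff cmod_power2 by (simp add: power2_eq_square algebra_simps)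
  then show ?thesis by simp
qed

lemma gap_eq: "(cmod (q - mid q'))\<^sup>2 + (Re q' * sin \<delta>)\<^sup>2 =
    (Re q)\<^sup>2 + (Re q')\<^sup>2 - 2 * Re q * Re q' * cos \<delta> + (Im q - Im q')\<^sup>2"
proof -
  have "(Re q' * sin \<delta>)\<^sup>2 = (Re q')\<^sup>2 - (Re q' * cos \<delta>)\<^sup>2"
    by (simp add: power_mult_distrib sin_squared_eq algebra_simps)
  then show ?thesis
    unfolding cmod_power2 by (simp add: mid_def power2_eq_square algebra_simps)
qed

lemma unit_gap_sym: "unit_gap q q' \<longleftrightarrow> unit_gap q' q"
  unfolding unit_gap_def gap_eq by (simp add: power2_commute algebra_simps)

lemma norm_vertex_unit_gap:
  assumes "unit_gap q q'"
  shows "norm (vertex q (\<theta> + \<delta>) - vertex q' \<theta>) = 1" "norm (vertex q' (\<theta> + \<delta>) - vertex q \<theta>) = 1"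
proof -
  have *: "norm (vertex x (\<theta> + \<delta>) - vertex y \<theta>) = 1" if "unit_gap x y" for x y
    using that unfolding unit_gap_def gap_eq by (intro norm_eq_1_if_square) (simp add: norm_vertex_diff)
  show "norm (vertex q (\<theta> + \<delta>) - vertex q' \<theta>) = 1" "norm (vertex q' (\<theta> + \<delta>) - vertex q \<theta>) = 1"
    using * assms unit_gap_sym by blast+
qed

text \<open>One flip moves a vertex from \<open>q\<close> to \<open>p\<close> within a plane through
  the axis, while its two neighbours on the ring \<open>q'\<close> stay.\<close>

lemma reduces_rotate_vertex:
  assumes g: "unit_gap q q'" "unit_gap p q'" and d: "cmod (q - p) = 1"
  shows "reduces r [vertex q (\<theta> + \<delta>) - vertex q' \<theta>, vertex q' (\<theta> + \<delta> + \<delta>) - vertex q (\<theta> + \<delta>)]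
     [vertex p (\<theta> + \<delta>) - vertex q' \<theta>, vertex q' (\<theta> + \<delta> + \<delta>) - vertex p (\<theta> + \<delta>)]"
  using d r1 norm_vertex_unit_gap(2)[OF g(1), of "\<theta> + \<delta>"] norm_vertex_unit_gap(2)[OF g(2), of "\<theta> + \<delta>"]
    norm_vertex_unit_gap(1)[OF g(1), of \<theta>] norm_vertex_unit_gap(1)[OF g(2), of \<theta>]
  by (intro reduces_flip) (simp_all add: norm_vertex_same_angle)

text \<open>For \<open>\<bar>a\<bar> * sin \<delta> \<le> 1/2\<close>, \<open>rad a\<close> is the squared distance from the axis of rotation, and
  \<open>rot\<close> is the rotation that moves points at this distance by 1.  The maximum makes \<open>rad\<close> a
  continuous function bounded away from 0 on all of the real line.\<close>

definition rad :: "real \<Rightarrow> real" where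
  "rad a = max (3 / 4) (1 - (a * sin \<delta>)\<^sup>2)"

text \<open>The cosine of the rotation angle, by the law of cosines for a chord of length 1 in a
  circle of squared radius \<open>rad a\<close>.\<close>

definition co :: "real \<Rightarrow> real" where
  "co a = 1 - 1 / (2 * rad a)"

definition rot :: "bool \<Rightarrow> real \<Rightarrow> complex" where
  "rot b a = Complex (co a) ((if b then 1 else -1) * sqrt (1 - (co a)\<^sup>2))"

text \<open>Multiplication acts in the plane through the axis that is perpendicular to a side of
  \<open>q'\<close> at its midpoint. Each of the three rotations turns by \<pi>/3 or a little more,
  so together they carry \<open>q\<close> roughly to the opposite side of
  \<open>mid q'\<close>.\<close>

definition next_ring :: "bool \<Rightarrow> complex \<Rightarrow> complex \<Rightarrow> complex" where
  "next_ring b q q' = mid q' + rot b (Re q') ^ 3 * (q - mid q')"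

lemma rad_bounds: "3 / 4 \<le> rad a" "rad a \<le> 1"
  by (auto simp: rad_def)

lemma co_bounds: "1 / 3 \<le> co a" "co a \<le> 1 / 2"
  using rad_bounds[of a] by (auto simp: co_def field_simps)

lemma co_sq: "(co a)\<^sup>2 \<le> 1 / 4"
proof -
  have "(co a)\<^sup>2 \<le> (1 / 2)\<^sup>2" using co_bounds[of a] by (intro power_mono) auto
  then show ?thesis by (simp add: power2_eq_square)
qed

lemma cmod_rot [simp]: "cmod (rot b a) = 1"
proof -
  have "(cmod (rot b a))\<^sup>2 = 1"
    unfolding cmod_power2 using co_sq[of a] by (simp add: rot_def)
  then show ?thesis by (rule norm_eq_1_if_square)
qed

lemma cmod_rot_minus_1: "(cmod (rot b a - 1))\<^sup>2 * rad a = 1"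
proof -
  have "(cmod (rot b a - 1))\<^sup>2 = (co a - 1)\<^sup>2 + (1 - (co a)\<^sup>2)"
    unfolding cmod_power2 using co_sq[of a] by (simp add: rot_def)
  also have "\<dots> = 2 - 2 * co a" by (simp add: power2_eq_square algebra_simps)
  finally show ?thesis using rad_bounds[of a] by (simp add: co_def)
qed

lemma unit_gap_next_ring:
  assumes "unit_gap q q'"
  shows "unit_gap q' (next_ring b q q')"
proof -
  have "cmod (next_ring b q q' - mid q') = cmod (q - mid q')"
    by (simp add: next_ring_def norm_mult norm_power)
  then have "unit_gap (next_ring b q q') q'" using assms by (simp add: unit_gap_def)
  then show ?thesis using unit_gap_sym by blast
qed

lemma reduces_next_ring:
  assumes g: "unit_gap q q'" and small: "\<bar>Re q'\<bar> * sin \<delta> \<le> 1 / 2"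
  shows "reduces r [vertex q (\<theta> + \<delta>) - vertex q' \<theta>, vertex q' (\<theta> + \<delta> + \<delta>) - vertex q (\<theta> + \<delta>)]
     [vertex (next_ring b q q') (\<theta> + \<delta>) - vertex q' \<theta>,
      vertex q' (\<theta> + \<delta> + \<delta>) - vertex (next_ring b q q') (\<theta> + \<delta>)]"
proof -
  define x where "x k = mid q' + rot b (Re q') ^ k * (q - mid q')" for k :: nat
  \<comment> \<open>The bound on the side makes the maximum in \<open>rad\<close> its second
    argument, which by \<open>unit_gap\<close> is the squared distance of \<open>q\<close> from
    \<open>mid q'\<close>.\<close>
  have "(\<bar>Re q'\<bar> * sin \<delta>)\<^sup>2 \<le> (1 / 2)\<^sup>2"
    using small sin_\<delta> by (intro power_mono) auto
  then have rad: "rad (Re q') = 1 - (Re q' * sin \<delta>)\<^sup>2"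
    by (simp add: rad_def power_mult_distrib power2_eq_square)
  have gap: "unit_gap (x k) q'" for k
    using g by (simp add: unit_gap_def x_def norm_mult norm_power)
  have "(cmod (x k - x (Suc k)))\<^sup>2 = 1" for k
  proof -
    have "x k - x (Suc k) = - (rot b (Re q') ^ k * ((rot b (Re q') - 1) * (q - mid q')))"
      by (simp add: x_def algebra_simps)
    then have "(cmod (x k - x (Suc k)))\<^sup>2 = (cmod (rot b (Re q') - 1))\<^sup>2 * (cmod (q - mid q'))\<^sup>2"
      by (simp add: norm_mult norm_power power_mult_distrib)
    also have "(cmod (q - mid q'))\<^sup>2 = rad (Re q')"
      using g by (simp add: unit_gap_def rad)
    finally show ?thesis by (simp add: cmod_rot_minus_1)
  qed
  from norm_eq_1_if_square[OF this] have d: "cmod (x k - x (Suc k)) = 1" for k .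
  note step = reduces_rotate_vertex[OF gap gap d, of _ \<theta>]
  have "x 0 = q" "x (Suc (Suc (Suc 0))) = next_ring b q q'"
    by (simp_all add: x_def next_ring_def numeral_3_eq_3)
  then show ?thesis
    using reduces_trans[OF reduces_trans[OF step[of 0] step[of "Suc 0"]] step[of "Suc (Suc 0)"]] by simp
qed

section \<open>Zigzag words between two rings\<close>

lemma domed_word_zigzag_shift:
  assumes "domed_word (blow_up r (zigzag q q' \<phi>))"
  shows "domed_word (blow_up r (concat (map (\<lambda>i.
     [vertex q (angle \<phi> (2 * i + 1) + \<delta>) - vertex q' (angle \<phi> (2 * i + 1)),
      vertex q' (angle \<phi> (2 * i + 1) + \<delta> + \<delta>) - vertex q (angle \<phi> (2 * i + 1) + \<delta>)]) [0..<n])))"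
proof -
  let ?f = "\<lambda>i. vertex q' (angle \<phi> (2 * i + 1)) - vertex q (angle \<phi> (2 * i))"
  have "?f n = ?f 0"
    using vertex_angle_periodic[of q' \<phi> 1] vertex_angle_periodic[of q \<phi> 0] by simp
  then show ?thesis
    using domed_word_shift_pairs[of r ?f _ n] assms n3
    unfolding zigzag_def by (simp add: angle_Suc)
qed

lemma domed_word_zigzag_next:
  assumes "domed_word (blow_up r (zigzag q q' \<phi>))" "unit_gap q q'" "\<bar>Re q'\<bar> * sin \<delta> \<le> 1 / 2"
  shows "domed_word (blow_up r (zigzag q' (next_ring b q q') (\<phi> + \<delta>)))"
proof -
  have "domed_word (blow_up r (concat (map (\<lambda>i.
     [vertex (next_ring b q q') (angle \<phi> (2 * i + 1) + \<delta>) - vertex q' (angle \<phi> (2 * i + 1)),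
      vertex q' (angle \<phi> (2 * i + 1) + \<delta> + \<delta>) - vertex (next_ring b q q') (angle \<phi> (2 * i + 1) + \<delta>)]) [0..<n])))"
    by (rule domed_word_concat_reduces[OF reduces_next_ring[OF assms(2,3)] _ _ n3 domed_word_zigzag_shift[OF assms(1)]])
      auto
  then show ?thesis
    by (simp add: zigzag_def angle_Suc)
qed

lemma domed_word_zigzag_ngon:
  assumes D: "domed_word (blow_up r (zigzag q q' \<phi>))" and g: "unit_gap q q'"
    and side: "\<bar>Re q'\<bar> * sin \<delta> = 1 / 2"
  shows "domed_word (blow_up r (map (\<lambda>i. vertex q' (angle \<phi> (2 * i + 3)) - vertex q' (angle \<phi> (2 * i + 1))) [0..<n]))"
proof -
  have "(norm (vertex q' (\<theta> + \<delta> + \<delta>) - vertex q' \<theta>))\<^sup>2 = 1" for \<theta>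
  proof -
    have "(norm (vertex q' (\<theta> + \<delta> + \<delta>) - vertex q' \<theta>))\<^sup>2 = 2 * (Re q')\<^sup>2 * (1 - cos (2 * \<delta>))"
      unfolding norm_vertex_diff by (simp add: power2_eq_square algebra_simps)
    also have "\<dots> = 4 * (\<bar>Re q'\<bar> * sin \<delta>)\<^sup>2"
      by (simp add: cos_double_sin power_mult_distrib)
    finally show ?thesis unfolding side by (simp add: power2_eq_square)
  qed
  from norm_eq_1_if_square[OF this] have side: "norm (vertex q' (\<theta> + \<delta> + \<delta>) - vertex q' \<theta>) = 1" for \<theta> .
  \<comment> \<open>As the side of the ring \<open>q'\<close> is 1, the two letters meeting at a
    vertex of \<open>q\<close> merge into that side.\<close>
  have red: "reduces r [vertex q (\<theta> + \<delta>) - vertex q' \<theta>, vertex q' (\<theta> + \<delta> + \<delta>) - vertex q (\<theta> + \<delta>)]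
      [vertex q' (\<theta> + \<delta> + \<delta>) - vertex q' \<theta>]" for \<theta>
    using reduces_merge[OF r1, of "vertex q (\<theta> + \<delta>) - vertex q' \<theta>" "vertex q' (\<theta> + \<delta> + \<delta>) - vertex q (\<theta> + \<delta>)"]
      side norm_vertex_unit_gap(1)[OF g] norm_vertex_unit_gap(2)[OF g, of "\<theta> + \<delta>"] by simp
  have "domed_word (blow_up r (concat (map (\<lambda>i.
      [vertex q' (angle \<phi> (2 * i + 1) + \<delta> + \<delta>) - vertex q' (angle \<phi> (2 * i + 1))]) [0..<n])))"
    by (rule domed_word_concat_reduces[OF red _ _ n3 domed_word_zigzag_shift[OF D]]) auto
  then show ?thesis
    by (simp add: angle_Suc numeral_3_eq_3 concat_map_singleton)
qed

section \<open>Rings grown from an apex\<close>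

lemma domed_word_zigzag_apex:
  assumes "h\<^sup>2 + t\<^sup>2 = 1"
  shows "domed_word (blow_up r (zigzag (Complex 0 h) (Complex t 0) \<phi>))" "unit_gap (Complex 0 h) (Complex t 0)"
proof -
  show g: "unit_gap (Complex 0 h) (Complex t 0)"
    unfolding unit_gap_def gap_eq using assms by simp
  define p where "p i = vertex (Complex t 0) (angle \<phi> (2 * i + 1)) - vertex (Complex 0 h) (angle \<phi> (2 * i))" for i
  have p1: "norm (p i) = 1" for i
    using norm_vertex_unit_gap(2)[OF g] by (simp add: p_def angle_Suc)
  \<comment> \<open>A ring of radius 0 is a single point, so the zigzag runs out from it and back,
    as a star of spikes.\<close>
  have "zigzag (Complex 0 h) (Complex t 0) \<phi> = concat (map (\<lambda>p. [p, - p]) (map p [0..<n]))"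
    unfolding zigzag_def map_map by (simp add: comp_def p_def vertex_def)
  then show "domed_word (blow_up r (zigzag (Complex 0 h) (Complex t 0) \<phi>))"
    using domed_word_star[OF r1, of "map p [0..<n]"] p1 n3 by auto
qed

text \<open>The pair holds the last two rings. The senses of rotation are listed with the latest
  first, and \<open>t\<close> is the radius of the first ring around the apex.\<close>

fun rings :: "bool list \<Rightarrow> real \<Rightarrow> complex \<times> complex" where
  "rings [] t = (Complex 0 (sqrt (1 - t\<^sup>2)), Complex t 0)"
| "rings (b # l) t = (snd (rings l t), next_ring b (fst (rings l t)) (snd (rings l t)))"

lemma unit_gap_rings:
  assumes "0 \<le> t" "t \<le> 1"
  shows "unit_gap (fst (rings l t)) (snd (rings l t))"
proof (induction l)
  case Nil
  have "t\<^sup>2 \<le> 1" using assms by (simp add: power_le_one)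
  then show ?case using domed_word_zigzag_apex(2)[of "sqrt (1 - t\<^sup>2)" t] by simp
next
  case (Cons b l)
  then show ?case using unit_gap_next_ring by simp
qed

lemma continuous_on_rings:
  "continuous_on {0..1} (\<lambda>t. fst (rings l t)) \<and> continuous_on {0..1} (\<lambda>t. snd (rings l t))"
proof (induction l)
  case Nil
  have "continuous_on {0..1} (\<lambda>t. Complex 0 (sqrt (1 - t\<^sup>2)))" "continuous_on {0..1} (\<lambda>t::real. Complex t 0)"
    unfolding complex_eq by (intro continuous_intros)+
  then show ?case by simp
next
  case (Cons b l)
  \<comment> \<open>The lower bound built into \<open>rad\<close> makes the quotient in
    \<open>co\<close> continuous, even where a ring has side greater than 1.\<close>
  have rad: "rad x \<noteq> 0" for x using rad_bounds[of x] by auto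
  have "continuous_on {0..1} (\<lambda>t. next_ring b (fst (rings l t)) (snd (rings l t)))"
    using Cons unfolding next_ring_def rot_def co_def rad_def mid_def Complex_eq 
    by (auto intro!: continuous_intros simp: rad[unfolded rad_def])
  then show ?case using Cons by simp
qed

text \<open>For rings of radius 0 the rotation angle is exactly \<pi>/3; three rotations make a half
  turn about a point of the axis, which preserves the axis.\<close>

lemma Re_rings_0: "Re (fst (rings l 0)) = 0 \<and> Re (snd (rings l 0)) = 0"
proof (induction l)
  case (Cons b l)
  have "rot b 0 ^ 3 = -1"
  proof -
    have co0: "co 0 = 1 / 2" by (simp add: co_def rad_def)
    have rot0: "rot b 0 = Complex (1 / 2) ((if b then 1 else -1) * sqrt (3 / 4))"
      unfolding rot_def co0 by (simp add: power2_eq_square)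
    show ?thesis
      unfolding rot0 by (auto simp: complex_eq_iff power3_eq_cube real_sqrt_divide algebra_simps)
  qed
  then show ?case using Cons by (simp add: next_ring_def mid_def)
qed simp

text \<open>\<open>A\<close> and \<open>B\<close> measure by how much the triple rotation differs
  from a half turn; the two senses of rotation give opposite signs of \<open>B\<close>.\<close>

lemma rot_cube:
  obtains A B where "rot True a ^ 3 = - Complex A B" "rot False a ^ 3 = - Complex A (- B)"
    "4 / 5 \<le> A" "A \<le> 1" "0 \<le> B" "B \<le> 3 / 5"
proof -
  define K where "K = co a"
  define Y where "Y = sqrt (1 - K\<^sup>2)"
  have K: "1 / 3 \<le> K" "K \<le> 1 / 2" "K\<^sup>2 \<le> 1 / 4"
    using co_bounds[of a] co_sq[of a] by (auto simp: K_def)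
  have Y: "Y \<ge> 0" "Y * Y = 1 - K * K" using K by (auto simp: Y_def power2_eq_square)
  \<comment> \<open>The triple-angle formulas, with the signs of cosine and sine reversed.\<close>
  define A where "A = 3 * K - 4 * K ^ 3"
  define B where "B = Y * (1 - 4 * K\<^sup>2)"
  have re: "K * (K * K - Y * Y) - Y * (K * Y + Y * K) = - A" and im: "K * (K * Y + Y * K) + Y * (K * K - Y * Y) = - B"
    using Y(2) unfolding A_def B_def by algebra+
  have rT: "rot True a ^ 3 = - Complex A B" and rF: "rot False a ^ 3 = - Complex A (- B)"
    unfolding rot_def K_def[symmetric] Y_def[symmetric]
    using re im by (auto simp: complex_eq_iff power3_eq_cube algebra_simps)
  have "(cmod (rot True a ^ 3))\<^sup>2 = 1" by (simp add: norm_power)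
  then have AB: "A\<^sup>2 + B\<^sup>2 = 1" unfolding rT cmod_power2 by simp
  \<comment> \<open>23/27 is the value of \<open>A\<close> at the smallest possible
    \<open>K\<close>, which is 1/3.\<close>
  have "A - 23 / 27 = (K - 1 / 3) * (3 - 4 * (K\<^sup>2 + K / 3 + 1 / 9))"
    unfolding A_def by (simp add: power2_eq_square power3_eq_cube field_simps)
  also have "\<dots> \<ge> 0" using K by (intro mult_nonneg_nonneg) auto
  finally have A: "4 / 5 \<le> A" by simp
  have B0: "0 \<le> B" unfolding B_def using Y K by (intro mult_nonneg_nonneg) auto
  have "(4 / 5)\<^sup>2 \<le> A\<^sup>2" using A by (intro power_mono) auto
  then have "B\<^sup>2 \<le> (3 / 5)\<^sup>2" using AB by (simp add: power2_eq_square)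
  then have B: "B \<le> 3 / 5" by (rule power2_le_imp_le) simp
  have "A\<^sup>2 \<le> 1\<^sup>2" using AB zero_le_power2[of B] unfolding one_power2 by linarith
  then have "A \<le> 1" by (rule power2_le_imp_le) simp
  then show ?thesis using that rT rF A B0 B by blast
qed

text \<open>Choosing the sense of each rotation against the current slope keeps the slope bounded, so the
  radii of the rings grow at least linearly.\<close>

lemma rings_growth:
  assumes small: "\<And>l. \<bar>Re (snd (rings l 1))\<bar> * sin \<delta> < 1 / 2"
  shows "\<exists>l. real k * (7 / 20) \<le> Re (snd (rings l 1)) \<and>
    0 < cos \<delta> * Re (snd (rings l 1)) - Re (fst (rings l 1)) \<and>
    \<bar>Im (snd (rings l 1)) - Im (fst (rings l 1))\<bar> \<le> 3 / 5"
proof (induction k)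
  case 0
  show ?case using cos_\<delta> by (intro exI[of _ "[]"]) simp
next
  case (Suc k)
  then obtain l where l: "real k * (7 / 20) \<le> Re (snd (rings l 1))"
    "0 < cos \<delta> * Re (snd (rings l 1)) - Re (fst (rings l 1))"
    "\<bar>Im (snd (rings l 1)) - Im (fst (rings l 1))\<bar> \<le> 3 / 5"
    by blast
  define q where "q = fst (rings l 1)"
  define q' where "q' = snd (rings l 1)"
  define s where "s = sin \<delta>"
  define c where "c = cos \<delta>"
  define a where "a = Re q'"
  \<comment> \<open>\<open>X\<close> and \<open>\<eta>\<close> are the components of
    \<open>mid q' - q\<close>; the invariant says that \<open>X\<close> is positive and
    \<open>\<bar>\<eta>\<bar>\<close> at most 3/5.\<close>
  define X where "X = c * Re q' - Re q"
  define \<eta> where "\<eta> = Im q' - Im q"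
  note defs = q_def q'_def s_def c_def a_def X_def \<eta>_def
  \<comment> \<open>The empty list gives the ring of radius 1, so the assumption bounds
    \<open>s\<close> itself.\<close>
  have s: "0 < s" "s < 1 / 2" using sin_\<delta> small[of "[]"] by (auto simp: s_def)
  have cs: "c\<^sup>2 = 1 - s\<^sup>2" by (simp add: c_def s_def cos_squared_eq)
  have c: "0 < c" "c \<le> 1" using cos_\<delta> by (auto simp: c_def)
  have "s\<^sup>2 \<le> (1 / 2)\<^sup>2" using s by (intro power_mono) auto
  then have "(17 / 20)\<^sup>2 \<le> c\<^sup>2" using cs by (simp add: power2_eq_square)
  then have c': "17 / 20 \<le> c" by (rule power2_le_imp_le) (use c in simp)
  have a0: "0 \<le> a" using l(1) by (simp add: defs)
  have as: "a * s < 1 / 2" using small[of l] a0 by (simp add: defs)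
  have "(a * s)\<^sup>2 \<le> (1 / 2)\<^sup>2" using as a0 s by (intro power_mono) auto
  then have as2: "(a * s)\<^sup>2 \<le> 1 / 4" by (simp add: power2_eq_square)
  have g: "unit_gap q q'" using unit_gap_rings[of 1 l] by (simp add: defs)
  have qm: "q - mid q' = - Complex X \<eta>" by (simp add: mid_def defs complex_eq_iff)
  have gX: "X\<^sup>2 + \<eta>\<^sup>2 + (a * s)\<^sup>2 = 1"
    using g unfolding unit_gap_def qm cmod_power2 by (simp add: a_def s_def)
  then have "X\<^sup>2 \<le> 1\<^sup>2" using zero_le_power2[of \<eta>] zero_le_power2[of "a * s"]
    unfolding one_power2 by linarith
  then have X: "0 < X" "X \<le> 1" using l(2) power2_le_imp_le[of X 1] by (auto simp: defs)
  have \<eta>: "\<bar>\<eta>\<bar> \<le> 3 / 5" using l(3) by (simp add: defs)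
  obtain A B where AB: "rot True a ^ 3 = - Complex A B" "rot False a ^ 3 = - Complex A (- B)"
    "4 / 5 \<le> A" "A \<le> 1" "0 \<le> B" "B \<le> 3 / 5"
    using rot_cube .
  \<comment> \<open>With this sense, the two terms of \<open>Re u\<close> are both nonnegative,
    while those of \<open>Im u\<close> have opposite signs and absolute values at most 3/5, so that
    they cannot add up.\<close>
  define b where "b \<longleftrightarrow> \<eta> < 0"
  define q'' where "q'' = next_ring b q q'"
  define u where "u = q'' - mid q'"
  have u: "u = Complex A (if b then B else - B) * Complex X \<eta>"
    using AB by (simp add: u_def q''_def next_ring_def a_def[symmetric] qm)
  have BX: "0 \<le> B * X" "B * X \<le> 3 / 5" "0 < A * X" "0 \<le> B * \<bar>\<eta>\<bar>"
    using AB X mult_mono[of B "3 / 5" X 1] by auto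
  have A\<eta>: "A * \<bar>\<eta>\<bar> \<le> 3 / 5" "0 \<le> A * \<bar>\<eta>\<bar>" using AB \<eta> mult_mono[of A 1 "\<bar>\<eta>\<bar>" "3 / 5"] by auto
  have Re: "0 < Re u" and Im: "\<bar>Im u\<bar> \<le> 3 / 5"
    using BX A\<eta> by (auto simp: u b_def abs_if algebra_simps)
  have "unit_gap q'' q'" using unit_gap_next_ring[OF g] unit_gap_sym by (auto simp: q''_def)
  then have gu: "(Re u)\<^sup>2 + (Im u)\<^sup>2 + (a * s)\<^sup>2 = 1"
    unfolding unit_gap_def u_def[symmetric] cmod_power2 by (simp add: a_def s_def)
  \<comment> \<open>The square of \<open>Re u\<close> is at least 1 - 9/25 - 1/4 = 39/100, which
    exceeds 9/25.\<close>
  have "\<bar>Im u\<bar>\<^sup>2 \<le> (3 / 5)\<^sup>2" using Im by (intro power_mono) auto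
  then have "(3 / 5)\<^sup>2 \<le> (Re u)\<^sup>2" using gu as2 by (simp add: power2_eq_square)
  then have Re': "3 / 5 \<le> Re u" by (rule power2_le_imp_le) (use Re in simp)
  have a'': "Re q'' = c * a + Re u" by (simp add: u_def mid_def a_def c_def)
  have s2a: "s\<^sup>2 * a \<le> 1 / 4"
    using mult_mono[of s "1 / 2" "a * s" "1 / 2"] s as a0 by (simp add: power2_eq_square algebra_simps)
  have "c * Re q'' - a = c * Re u - (1 - c\<^sup>2) * a"
    by (simp add: a'' power2_eq_square algebra_simps)
  also have "\<dots> \<ge> 17 / 20 * (3 / 5) - 1 / 4"
    using s2a mult_mono[OF c' Re'] c Re by (simp add: cs)
  finally have 1: "0 < c * Re q'' - a" by simp
  \<comment> \<open>Since \<open>1 - c\<close> is at most \<open>1 - c\<^sup>2\<close>, shrinking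
    \<open>a\<close> to \<open>c * a\<close> costs at most 1/4; the gain 7/20 is 3/5 - 1/4.\<close>
  have "c\<^sup>2 \<le> c" using c by (simp add: power2_eq_square mult_left_le)
  then have "(1 - c) * a \<le> s\<^sup>2 * a" using cs a0 by (intro mult_right_mono) auto
  then have 2: "Re q'' \<ge> a + 7 / 20" using s2a Re' by (simp add: a'' algebra_simps)
  have 3: "\<bar>Im q'' - Im q'\<bar> \<le> 3 / 5" using Im by (simp add: u_def mid_def)
  have "rings (b # l) 1 = (q', q'')" by (simp add: q''_def defs)
  then show ?case
    using 1 2 3 l(1) by (intro exI[of _ "b # l"]) (simp add: a_def c_def q'_def algebra_simps)
qed

text \<open>Without a ring of side 1, two facts feed each other along \<open>l\<close>: if the
  zigzags of \<open>l\<close> are domed for all \<open>t\<close>, the intermediate value theorem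
  keeps the side below 1, and this bound lets the next ring be built. The growth at
  \<open>t = 1\<close> then gives a contradiction.\<close>

lemma ex_domed_zigzag:
  "\<exists>q q'. unit_gap q q' \<and> \<bar>Re q'\<bar> * sin \<delta> = 1 / 2 \<and> (\<forall>\<phi>. domed_word (blow_up r (zigzag q q' \<phi>)))"
proof (rule ccontr)
  assume no: "\<not> ?thesis"
  have small: "\<bar>Re (snd (rings l t))\<bar> * sin \<delta> < 1 / 2"
    if D: "\<And>t \<phi>. 0 \<le> t \<Longrightarrow> t \<le> 1 \<Longrightarrow> domed_word (blow_up r (zigzag (fst (rings l t)) (snd (rings l t)) \<phi>))"
      and t: "0 \<le> t" "t \<le> 1" for l t
  proof (rule ccontr)
    assume big: "\<not> ?thesis"
    let ?f = "\<lambda>t. \<bar>Re (snd (rings l t))\<bar> * sin \<delta>"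
    have "continuous_on {0..1} ?f"
      using continuous_on_rings[of l] by (auto intro!: continuous_intros)
    then have "continuous_on {0..t} ?f"
      by (rule continuous_on_subset) (use t in auto)
    then obtain x where "0 \<le> x" "x \<le> t" "?f x = 1 / 2"
      using IVT'[of ?f 0 "1 / 2" t] big t Re_rings_0[of l] by auto
    then show False
      using no D[of x] unit_gap_rings[of x l] t by (meson order_trans)
  qed
  have D: "domed_word (blow_up r (zigzag (fst (rings l t)) (snd (rings l t)) \<phi>))"
    if "0 \<le> t" "t \<le> 1" for l t \<phi>
    using that
  proof (induction l arbitrary: t \<phi>)
    case Nil
    then have "t\<^sup>2 \<le> 1" by (simp add: power_le_one)
    then show ?case using domed_word_zigzag_apex(1)[of "sqrt (1 - t\<^sup>2)" t \<phi>] by simp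
  next
    case (Cons b l)
    then have "\<bar>Re (snd (rings l t))\<bar> * sin \<delta> \<le> 1 / 2" using small[of l t] by fastforce
    \<comment> \<open>Building a ring advances the starting angle by \<delta>, so the induction
      hypothesis is used at \<open>\<phi> - \<delta>\<close>.\<close>
    then show ?case
      using domed_word_zigzag_next[OF Cons.IH[OF Cons.prems, of "\<phi> - \<delta>"] unit_gap_rings[OF Cons.prems], of b]
      by simp
  qed
  have s1: "\<bar>Re (snd (rings l 1))\<bar> * sin \<delta> < 1 / 2" for l
    using small[OF D] by simp
  obtain k :: nat where k: "1 / (2 * sin \<delta>) / (7 / 20) \<le> real k"
    using real_arch_simple by blast
  obtain l where "real k * (7 / 20) \<le> Re (snd (rings l 1))"
    using rings_growth[OF s1, of k] by blast
  then have "1 / (2 * sin \<delta>) \<le> Re (snd (rings l 1))" using k by simp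
  then have "1 / 2 \<le> Re (snd (rings l 1)) * sin \<delta>" using sin_\<delta> by (simp add: field_simps)
  also have "\<dots> \<le> \<bar>Re (snd (rings l 1))\<bar> * sin \<delta>" using sin_\<delta> by (intro mult_right_mono) auto
  finally show False using s1[of l] by simp
qed

lemma domed_word_ngon:
  "domed_word (blow_up r (map (\<lambda>i. (1 / (2 * sin \<delta>)) *\<^sub>R
     ((cos (2 * real (i + 1) * \<delta>) *\<^sub>R e1 + sin (2 * real (i + 1) * \<delta>) *\<^sub>R e2) -
      (cos (2 * real i * \<delta>) *\<^sub>R e1 + sin (2 * real i * \<delta>) *\<^sub>R e2))) [0..<n]))"
proof -
  obtain q q' where q: "unit_gap q q'" "\<bar>Re q'\<bar> * sin \<delta> = 1 / 2"
    "\<And>\<phi>. domed_word (blow_up r (zigzag q q' \<phi>))"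
    using ex_domed_zigzag by blast
  \<comment> \<open>This puts the first vertex of the ring \<open>q'\<close> in direction
    \<open>e1\<close>; if the signed radius is negative, a half turn makes up for the sign.\<close>
  define \<phi> where "\<phi> = (if Re q' \<ge> 0 then - \<delta> else pi - \<delta>)"
  have v: "vertex q' (angle \<phi> (2 * i + 1)) =
    (1 / (2 * sin \<delta>)) *\<^sub>R (cos (2 * real i * \<delta>) *\<^sub>R e1 + sin (2 * real i * \<delta>) *\<^sub>R e2) + Im q' *\<^sub>R e3" for i
  proof -
    have "\<bar>Re q'\<bar> = 1 / (2 * sin \<delta>)" using q(2) sin_\<delta> by (simp add: field_simps)
    moreover have "Re q' * cos (angle \<phi> (2 * i + 1)) = \<bar>Re q'\<bar> * cos (2 * real i * \<delta>)"
      "Re q' * sin (angle \<phi> (2 * i + 1)) = \<bar>Re q'\<bar> * sin (2 * real i * \<delta>)"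
    proof -
      have "angle \<phi> (2 * i + 1) = (if Re q' \<ge> 0 then 0 else pi) + 2 * real i * \<delta>"
        by (simp add: angle_def \<phi>_def algebra_simps)
      then show "Re q' * cos (angle \<phi> (2 * i + 1)) = \<bar>Re q'\<bar> * cos (2 * real i * \<delta>)"
        "Re q' * sin (angle \<phi> (2 * i + 1)) = \<bar>Re q'\<bar> * sin (2 * real i * \<delta>)"
        by (auto simp: cos_add sin_add)
    qed
    ultimately show ?thesis
      unfolding vertex_def by (simp add: algebra_simps)
  qed
  have "vertex q' (angle \<phi> (2 * i + 3)) - vertex q' (angle \<phi> (2 * i + 1)) = (1 / (2 * sin \<delta>)) *\<^sub>R
     ((cos (2 * real (i + 1) * \<delta>) *\<^sub>R e1 + sin (2 * real (i + 1) * \<delta>) *\<^sub>R e2) -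
      (cos (2 * real i * \<delta>) *\<^sub>R e1 + sin (2 * real i * \<delta>) *\<^sub>R e2))" for i
  proof -
    have *: "2 * i + 3 = 2 * (i + 1) + 1" by simp
    show ?thesis unfolding * v scaleR_diff_right by simp
  qed
  then show ?thesis
    using domed_word_zigzag_ngon[OF q(3) q(1,2), of \<phi>] by simp
qed

end

section \<open>From words back to the subdivided polygon\<close>

lemma sum_list_replicate_scaleR: "sum_list (replicate r d) = real r *\<^sub>R d"
  for d :: "'a::real_vector"
  by (induction r) (auto simp: algebra_simps)

lemma walk_replicate: "walk u (replicate r d) = map (\<lambda>j. u + real j *\<^sub>R d) [0..<r]"
  for u d :: "'a::real_vector"
proof (induction r)
  case (Suc r)
  have "replicate (Suc r) d = replicate r d @ [d]" by (simp add: replicate_append_same)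
  then show ?case using Suc by (simp add: walk_append sum_list_replicate_scaleR del: replicate_Suc)
qed simp

text \<open>At step \<open>m\<close>, \<open>m div r\<close> sides are complete and
  \<open>m mod r\<close> unit steps of the current side are done.\<close>

lemma walk_blow_up:
  fixes k d :: "nat \<Rightarrow> 'a::real_vector"
  assumes r: "r \<ge> 1" and d: "\<And>i. k (Suc i) = k i + real r *\<^sub>R d i"
  shows "walk (k 0) (blow_up r (map d [0..<n])) =
    map (\<lambda>m. k (m div r) + real (m mod r) *\<^sub>R d (m div r)) [0..<n * r]"
proof -
  have sum: "k 0 + sum_list (blow_up r (map d [0..<n])) = k n" for n
    by (induction n) (auto simp: d sum_list_replicate_scaleR add.assoc[symmetric])
  show ?thesis
  proof (induction n)
    case (Suc n)
    have "[0..<Suc n * r] = [0..<n * r] @ map (\<lambda>j. j + n * r) [0..<r]"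
      using upt_add_eq_append[of 0 "n * r" r] by (simp add: map_add_upt add.commute)
    moreover have "walk (k n) (replicate r (d n)) =
        map (\<lambda>m. k (m div r) + real (m mod r) *\<^sub>R d (m div r)) (map (\<lambda>j. j + n * r) [0..<r])"
      using r by (simp add: walk_replicate)
    ultimately show ?case
      using Suc by (simp add: walk_append sum)
  qed simp
qed

theorem theorem1p3:
  fixes n r :: nat and c e1 e2 :: "real^3"
  assumes "n \<ge> 3" and "r \<ge> 1"
    and "e1 \<bullet> e1 = 1" and "e2 \<bullet> e2 = 1" and "e1 \<bullet> e2 = 0"
  shows "can_be_domed (subdivided_ngon n r c e1 e2)"
proof -
  \<comment> \<open>\<open>e3\<close> spans the axis perpendicular to the plane of the
    polygon.\<close>
  obtain e3 where e3: "norm e3 = 1" "e1 \<bullet> e3 = 0" "e2 \<bullet> e3 = 0"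
    using ex_unit_orthogonal .
  interpret ring_frame n r e1 e2 e3
    by unfold_locales (use assms e3 in \<open>auto simp: norm_eq_1\<close>)
  define k where "k = ngon_corner n r c e1 e2"
  define d where "d i = (1 / real r) *\<^sub>R (k (i + 1) - k i)" for i
  have "d = (\<lambda>i. (1 / (2 * sin \<delta>)) *\<^sub>R
     ((cos (2 * real (i + 1) * \<delta>) *\<^sub>R e1 + sin (2 * real (i + 1) * \<delta>) *\<^sub>R e2) -
      (cos (2 * real i * \<delta>) *\<^sub>R e1 + sin (2 * real i * \<delta>) *\<^sub>R e2)))"
  proof
    fix i
    have *: "k i = c + (real r / (2 * sin \<delta>)) *\<^sub>R
        (cos (2 * real i * \<delta>) *\<^sub>R e1 + sin (2 * real i * \<delta>) *\<^sub>R e2)" for i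
      by (simp add: k_def ngon_corner_def \<delta>_def mult_ac)
    show "d i = (1 / (2 * sin \<delta>)) *\<^sub>R
     ((cos (2 * real (i + 1) * \<delta>) *\<^sub>R e1 + sin (2 * real (i + 1) * \<delta>) *\<^sub>R e2) -
      (cos (2 * real i * \<delta>) *\<^sub>R e1 + sin (2 * real i * \<delta>) *\<^sub>R e2))"
      using \<open>r \<ge> 1\<close> unfolding d_def * add_diff_cancel_left scaleR_diff_right[symmetric] by simp
  qed
  then have "domed_word (blow_up r (map d [0..<n]))"
    using domed_word_ngon by simp
  then have "can_be_domed (walk (k 0) (blow_up r (map d [0..<n])))"
    by (simp add: domed_word_def)
  also have "walk (k 0) (blow_up r (map d [0..<n])) =
      map (\<lambda>m. k (m div r) + real (m mod r) *\<^sub>R d (m div r)) [0..<n * r]"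
    by (rule walk_blow_up) (use \<open>r \<ge> 1\<close> in \<open>auto simp: d_def\<close>)
  also have "\<dots> = subdivided_ngon n r c e1 e2"
    unfolding subdivided_ngon_def k_def[symmetric] by (simp add: d_def)
  finally show ?thesis .
qed

end
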